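(* Assume A1 (the Hessian of $f$ is $L$-Lipschitz) and A2 ($\nabla^2f(x)\succeq\mu I$ for all $x\in Q$, for some $\mu>0$). Let $\tau_0>0$, $\epsilon>0$, $m\in\mathbb{N}\setminus\{0\}$, and $$\kappa:=\frac{\mu^2}{2}\Bigl[3\cdot2^6\Bigl(\frac23\Bigr)^{1/3}m\max\{\tau_0,L\}+8L+\frac{c^2L^2m}{\tau_0}\Bigr]^{-1},\qquad c:=\frac{1}{3^{1/6}\,2^{13/6}}.$$ Let $x_0\in\mathcal{Q}_{\epsilon,\kappa}:=\{x\in Q:\ \epsilon\le\|F'(x)\|\le\frac{\kappa}{2}\}$, and let the initial regularization parameter be sufficiently big: $$\tau_0\ge\frac{2c_g^2L}{3},\qquad c_g:=\frac{1}{3^{1/3}\,2^2\,(2/3)^{1/6}}.$$ Run the algorithm Zero-Order CNM (described in the context) with inputs $x_0,\tau_0,\epsilon,m$, and let $x_{k,\ell}(t)$ be the $t$-th iterate of ZeroOrderCubicSteps in the call made at the $k$-th iteration of Zero-Order CNM in the $\ell$-th inner loop (so $x_{k,\ell}(0)=x_k$). Let $T(\epsilon)\le+\infty$ be the first iteration index such that $\|\nabla f(x_{T(\epsilon),\ell}(t))+\psi'(x_{T(\epsilon),\ell}(t))\|\le\epsilon$ for some $\ell\ge0$ and $t\in\{0,\dots,m\}$. Then $$T(\epsilon)\;\le\;\frac{1}{\log_2(1+m)}\,\log_2\log_2\frac{\kappa}{\epsilon}+1.$$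
   Context: Setting: $\|\cdot\|$ is the Euclidean norm for vectors and the spectral norm for matrices; $e_1,\dots,e_n$ is the standard basis of $\mathbb{R}^n$; $I$ is the identity matrix. $f:\mathbb{R}^n\to\mathbb{R}$ is twice continuously differentiable, $\psi:\mathbb{R}^n\to\mathbb{R}\cup\{+\infty\}$ is proper, closed and convex (possibly non-differentiable), $Q=\operatorname{dom}\psi$, $F=f+\psi$, and $F^\star=\inf_{x\in Q}F(x)>-\infty$. $\partial F(x)=\nabla f(x)+\partial\psi(x)$, and $F'(x)\in\partial F(x)$ denotes a given selection of subgradients. Assumption A1: $\|\nabla^2 f(y)-\nabla^2 f(x)\|\le L\|y-x\|$ for all $x,y\in\mathbb{R}^n$, where $L\ge 0$. Assumption A2: $\nabla^2f(x)\succeq\mu I$ for all $x\in Q$, for some $\mu>0$. Procedure ZeroOrderCubicSteps$(x,B,\sigma,m,\epsilon)$ ($x\in Q$, $B=B^\top\in\mathbb{R}^{n\times n}$, $\sigma>0$, $m\ge1$, $\epsilon>0$): Step 0: set $x_0:=x$, $t:=0$. Step 1: if $t=m$, stop and return $(x_t,\text{success})$. Step 2: with $h_g=\frac{1}{3^{1/3}}\bigl[\frac{\epsilon m}{\sigma n^{1/2}}\bigr]^{1/2}$ compute $g_t\in\mathbb{R}^n$ by $[g_t]^{(i)}=\frac{f(x_t+h_ge_i)-f(x_t-h_ge_i)}{2h_g}$, $i=1,\dots,n$. Step 3: with $M_{x_t,\sigma}(y)=f(x_t)+\langle g_t,y-x_t\rangle+\frac12\langle B(y-x_t),y-x_t\rangle+\frac{\sigma}{6}\|y-x_t\|^3$,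 compute $x_{t+1}\in Q$ as an approximate minimizer of $M_{x_t,\sigma}+\psi$ over $Q$ such that $M_{x_t,\sigma}(x_{t+1})+\psi(x_{t+1})\le F(x_t)$ and $\|\nabla M_{x_t,\sigma}(x_{t+1})+\psi'(x_{t+1})\|\le\frac{\sigma}{4}\|x_{t+1}-x_t\|^2$ for some $\psi'(x_{t+1})\in\partial\psi(x_{t+1})$. Step 4: if $F(x_0)-F(x_{t+1})\ge\frac{\epsilon^{3/2}}{384\,\sigma^{1/2}}(t+1)$, set $t:=t+1$ and go to Step 1; otherwise stop and return $(x_{t+1},\text{halt})$. For an iterate $x_{t}$ with $t\ge1$, $\psi'(x_{t})$ denotes the subgradient appearing in Step 3; for a starting point it is the one of the given selection. Algorithm Zero-Order CNM: Step 0: given $x_0\in Q$, $\tau_0>0$, $\epsilon>0$, $m\ge1$, set $k:=0$. Step 1: set $\ell:=0$. Step 1.1: with $\sigma_{k,\ell}=2^4(2/3)^{1/3}(2^\ell\tau_k)m$ and $h_{k,\ell}=\Bigl[\frac{3^4\sigma_{k,\ell}^{3/2}\epsilon^{3/2}}{2^{14}\cdot192\,n^3(2^\ell\tau_k)^3}\Bigr]^{1/3}$, compute $B_{k,\ell}=\frac12(A_{k,\ell}+A_{k,\ell}^\top)$ where, with $h=h_{k,\ell}$, $[A_{k,\ell}]^{(i,j)}=\frac{f(x_k+he_i+he_j)-f(x_k+he_i)-f(x_k+he_j)+f(x_k)}{h^2}$, $i,j=1,\dots,n$. Step 1.2: $(\hat x_{k,\ell},\alpha_{k,\ell})=$ ZeroOrderCubicSteps$(x_k,B_{k,\ell},\sigma_{k,\ell},m,\epsilon)$.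 Step 2: if $\alpha_{k,\ell}=\text{halt}$, set $\ell:=\ell+1$ and go to Step 1.1. Step 3: let $\ell_k$ be the current $\ell$; set $x_{k+1}=\hat x_{k,\ell_k}$, $\tau_{k+1}=\max\{\tau_0,2^{\ell_k-1}\tau_k\}$, $k:=k+1$, and go to Step 1. *)

theory Defs
  imports "HOL-Analysis.Analysis"
begin

section \<open>Smooth part\<close>

definition gradient :: "((real^'n) \<Rightarrow> real) \<Rightarrow> real^'n \<Rightarrow> real^'n" where
  "gradient f x = (THE D. GDERIV f x :> D)"

definition hessian :: "((real^'n) \<Rightarrow> real) \<Rightarrow> real^'n \<Rightarrow> real^'n^'n" where
  "hessian f x = jacobian (gradient f) (at x)"

definition twice_cont_diff :: "((real^'n) \<Rightarrow> real) \<Rightarrow> bool" where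
  "twice_cont_diff f \<longleftrightarrow>
     (\<forall>x. f differentiable (at x)) \<and> (\<forall>x. gradient f differentiable (at x)) \<and>
     continuous_on UNIV (hessian f)"

definition spectral_norm :: "real^'n^'n \<Rightarrow> real" where
  "spectral_norm A = onorm ((*v) A)"

definition psd :: "real^'n^'n \<Rightarrow> bool" where
  "psd A \<longleftrightarrow> transpose A = A \<and> (\<forall>v. 0 \<le> v \<bullet> (A *v v))"

section \<open>Composite part\<close>

definition ext_epigraph :: "((real^'n) \<Rightarrow> ereal) \<Rightarrow> ((real^'n) \<times> real) set" where
  "ext_epigraph \<psi> = {(x, r). \<psi> x \<le> ereal r}"

definition proper_closed_convex :: "((real^'n) \<Rightarrow> ereal) \<Rightarrow> bool" where
  "proper_closed_convex \<psi> \<longleftrightarrow>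
     (\<forall>x. \<psi> x \<noteq> -\<infinity>) \<and> (\<exists>x. \<psi> x \<noteq> \<infinity>) \<and>
     closed (ext_epigraph \<psi>) \<and> convex (ext_epigraph \<psi>)"

definition edom :: "((real^'n) \<Rightarrow> ereal) \<Rightarrow> (real^'n) set" where
  "edom \<psi> = {x. \<psi> x < \<infinity>}"

definition subdiff :: "((real^'n) \<Rightarrow> ereal) \<Rightarrow> real^'n \<Rightarrow> (real^'n) set" where
  "subdiff \<psi> x = {s. x \<in> edom \<psi> \<and> (\<forall>y. \<psi> x + ereal (s \<bullet> (y - x)) \<le> \<psi> y)}"

definition objective :: "((real^'n) \<Rightarrow> real) \<Rightarrow> ((real^'n) \<Rightarrow> ereal) \<Rightarrow> real^'n \<Rightarrow> ereal" where
  "objective f \<psi> x = ereal (f x) + \<psi> x"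

definition objective_subdiff ::
    "((real^'n) \<Rightarrow> real) \<Rightarrow> ((real^'n) \<Rightarrow> ereal) \<Rightarrow> real^'n \<Rightarrow> (real^'n) set" where
  "objective_subdiff f \<psi> x = (\<lambda>s. gradient f x + s) ` subdiff \<psi> x"

text \<open>The subdifferential may be empty at boundary points of the domain, so a selection
  of subgradients is only constrained at points where a subgradient exists.\<close>

definition subgradient_selection ::
    "((real^'n) \<Rightarrow> real) \<Rightarrow> ((real^'n) \<Rightarrow> ereal) \<Rightarrow> ((real^'n) \<Rightarrow> real^'n) \<Rightarrow> bool" where
  "subgradient_selection f \<psi> F' \<longleftrightarrow>
     (\<forall>x. objective_subdiff f \<psi> x \<noteq> {} \<longrightarrow> F' x \<in> objective_subdiff f \<psi> x)"

text \<open>Membership in this set includes that a subgradient exists at the point.\<close>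

definition local_region ::
    "((real^'n) \<Rightarrow> real) \<Rightarrow> ((real^'n) \<Rightarrow> ereal) \<Rightarrow> ((real^'n) \<Rightarrow> real^'n) \<Rightarrow>
     real \<Rightarrow> real \<Rightarrow> (real^'n) set" where
  "local_region f \<psi> F' \<epsilon> \<kappa> =
     {x \<in> edom \<psi>. objective_subdiff f \<psi> x \<noteq> {} \<and> \<epsilon> \<le> norm (F' x) \<and> norm (F' x) \<le> \<kappa> / 2}"

section \<open>Finite differences\<close>

definition fd_gradient :: "((real^'n) \<Rightarrow> real) \<Rightarrow> real \<Rightarrow> real^'n \<Rightarrow> real^'n" where
  "fd_gradient f h x = (\<chi> i. (f (x + h *\<^sub>R axis i 1) - f (x - h *\<^sub>R axis i 1)) / (2 * h))"

definition fd_matrix :: "((real^'n) \<Rightarrow> real) \<Rightarrow> real \<Rightarrow> real^'n \<Rightarrow> real^'n^'n" where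
  "fd_matrix f h x = (\<chi> i j.
     (f (x + h *\<^sub>R axis i 1 + h *\<^sub>R axis j 1) - f (x + h *\<^sub>R axis i 1)
        - f (x + h *\<^sub>R axis j 1) + f x) / h\<^sup>2)"

definition fd_hessian :: "((real^'n) \<Rightarrow> real) \<Rightarrow> real \<Rightarrow> real^'n \<Rightarrow> real^'n^'n" where
  "fd_hessian f h x = (1/2) *\<^sub>R (fd_matrix f h x + transpose (fd_matrix f h x))"

section \<open>Zero-order cubic steps\<close>

definition grad_stepsize :: "nat \<Rightarrow> real \<Rightarrow> nat \<Rightarrow> real \<Rightarrow> real" where
  "grad_stepsize n \<sigma> m \<epsilon> =
     1 / 3 powr (1/3) * (\<epsilon> * real m / (\<sigma> * real n powr (1/2))) powr (1/2)"

definition cubic_model ::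
    "((real^'n) \<Rightarrow> real) \<Rightarrow> real^'n \<Rightarrow> real^'n^'n \<Rightarrow> real \<Rightarrow> real^'n \<Rightarrow> real^'n \<Rightarrow> real" where
  "cubic_model f g B \<sigma> x y =
     f x + g \<bullet> (y - x) + 1/2 * ((B *v (y - x)) \<bullet> (y - x)) + \<sigma> / 6 * norm (y - x) ^ 3"

text \<open>\<open>cubic_step f \<psi> B \<sigma> m \<epsilon> x x' s\<close>: the point \<open>x'\<close>, with certifying subgradient
  \<open>s\<close> of \<open>\<psi>\<close> at \<open>x'\<close>, is an admissible outcome of one inexact cubic step from \<open>x\<close>.\<close>

definition cubic_step ::
    "((real^'n) \<Rightarrow> real) \<Rightarrow> ((real^'n) \<Rightarrow> ereal) \<Rightarrow> real^'n^'n \<Rightarrow> real \<Rightarrow> nat \<Rightarrow> real \<Rightarrow>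
     real^'n \<Rightarrow> real^'n \<Rightarrow> real^'n \<Rightarrow> bool" where
  "cubic_step f \<psi> B \<sigma> m \<epsilon> x x' s \<longleftrightarrow>
     (let g = fd_gradient f (grad_stepsize CARD('n) \<sigma> m \<epsilon>) x;
          M = cubic_model f g B \<sigma> x
      in x' \<in> edom \<psi> \<and> s \<in> subdiff \<psi> x' \<and>
         ereal (M x') + \<psi> x' \<le> objective f \<psi> x \<and>
         norm (gradient M x' + s) \<le> \<sigma> / 4 * (norm (x' - x))\<^sup>2)"

definition decrease_test ::
    "((real^'n) \<Rightarrow> real) \<Rightarrow> ((real^'n) \<Rightarrow> ereal) \<Rightarrow> real \<Rightarrow> real \<Rightarrow> real^'n \<Rightarrow> nat \<Rightarrow> real^'n \<Rightarrow> bool" where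
  "decrease_test f \<psi> \<sigma> \<epsilon> x t y \<longleftrightarrow>
     objective f \<psi> x - objective f \<psi> y
       \<ge> ereal (\<epsilon> powr (3/2) / (384 * \<sigma> powr (1/2)) * real t)"

datatype status = Success | Halt

text \<open>Trace of one call of the procedure: the iterates are \<open>iter c t\<close> for
  \<open>t \<le> steps c\<close> (the last one is the returned point, also when the call halts), and
  \<open>subgr c t\<close>, for \<open>1 \<le> t \<le> steps c\<close>, is the subgradient of \<open>\<psi>\<close> found
  together with \<open>iter c t\<close>. Values at other indices are irrelevant.\<close>

record 'v call =
  iter :: "nat \<Rightarrow> 'v"
  subgr :: "nat \<Rightarrow> 'v"
  steps :: nat
  flag :: status

definition zero_order_cubic_steps ::
    "((real^'n) \<Rightarrow> real) \<Rightarrow> ((real^'n) \<Rightarrow> ereal) \<Rightarrow> real^'n \<Rightarrow> real^'n^'n \<Rightarrow> real \<Rightarrow> nat \<Rightarrow> real \<Rightarrow>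
     (real^'n) call \<Rightarrow> bool" where
  "zero_order_cubic_steps f \<psi> x B \<sigma> m \<epsilon> c \<longleftrightarrow>
     iter c 0 = x \<and> 1 \<le> steps c \<and> steps c \<le> m \<and>
     (\<forall>t < steps c. cubic_step f \<psi> B \<sigma> m \<epsilon> (iter c t) (iter c (Suc t)) (subgr c (Suc t))) \<and>
     (\<forall>t. 1 \<le> t \<and> t < steps c \<longrightarrow> decrease_test f \<psi> \<sigma> \<epsilon> (iter c 0) t (iter c t)) \<and>
     (case flag c of
        Success \<Rightarrow> steps c = m \<and> decrease_test f \<psi> \<sigma> \<epsilon> (iter c 0) (steps c) (iter c (steps c))
      | Halt \<Rightarrow> \<not> decrease_test f \<psi> \<sigma> \<epsilon> (iter c 0) (steps c) (iter c (steps c)))"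

section \<open>Zero-order cubic Newton method\<close>

text \<open>Here \<open>\<theta>\<close> stands for the trial value \<open>2 ^ l * \<tau> k\<close>.\<close>

definition cnm_sigma :: "nat \<Rightarrow> real \<Rightarrow> real" where
  "cnm_sigma m \<theta> = 2 ^ 4 * (2/3) powr (1/3) * \<theta> * real m"

definition cnm_stepsize :: "nat \<Rightarrow> nat \<Rightarrow> real \<Rightarrow> real \<Rightarrow> real" where
  "cnm_stepsize n m \<epsilon> \<theta> =
     (3 ^ 4 * cnm_sigma m \<theta> powr (3/2) * \<epsilon> powr (3/2) /
       (2 ^ 14 * 192 * real n ^ 3 * \<theta> ^ 3)) powr (1/3)"

text \<open>A run is given by the traces \<open>C k l\<close> of all calls. The inner loop over \<open>l\<close> ends at
  the first successful call; it is not presupposed that it ends. Accordingly \<open>executed C k l\<close>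
  says that the call \<open>(k, l)\<close> really takes place, and only such calls are constrained.\<close>

definition iteration_ends :: "(nat \<Rightarrow> nat \<Rightarrow> 'v call) \<Rightarrow> nat \<Rightarrow> bool" where
  "iteration_ends C k \<longleftrightarrow> (\<exists>l. flag (C k l) = Success)"

definition last_inner :: "(nat \<Rightarrow> nat \<Rightarrow> 'v call) \<Rightarrow> nat \<Rightarrow> nat" where
  "last_inner C k = (LEAST l. flag (C k l) = Success)"

definition executed :: "(nat \<Rightarrow> nat \<Rightarrow> 'v call) \<Rightarrow> nat \<Rightarrow> nat \<Rightarrow> bool" where
  "executed C k l \<longleftrightarrow> (\<forall>j<k. iteration_ends C j) \<and> (\<forall>i<l. flag (C k i) = Halt)"

definition zero_order_cnm ::
    "((real^'n) \<Rightarrow> real) \<Rightarrow> ((real^'n) \<Rightarrow> ereal) \<Rightarrow> real^'n \<Rightarrow> real \<Rightarrow> real \<Rightarrow> nat \<Rightarrow>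
     (nat \<Rightarrow> real^'n) \<Rightarrow> (nat \<Rightarrow> real) \<Rightarrow> (nat \<Rightarrow> nat \<Rightarrow> (real^'n) call) \<Rightarrow> bool" where
  "zero_order_cnm f \<psi> x0 \<tau>0 \<epsilon> m x \<tau> C \<longleftrightarrow>
     x 0 = x0 \<and> \<tau> 0 = \<tau>0 \<and>
     (\<forall>k l. executed C k l \<longrightarrow>
        zero_order_cubic_steps f \<psi> (x k)
          (fd_hessian f (cnm_stepsize CARD('n) m \<epsilon> (2 ^ l * \<tau> k)) (x k))
          (cnm_sigma m (2 ^ l * \<tau> k)) m \<epsilon> (C k l)) \<and>
     (\<forall>k. (\<forall>j\<le>k. iteration_ends C j) \<longrightarrow>
        x (Suc k) = iter (C k (last_inner C k)) (steps (C k (last_inner C k))) \<and>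
        \<tau> (Suc k) = max \<tau>0 (2 powi (int (last_inner C k) - 1) * \<tau> k))"

text \<open>Composite gradient at an iterate of a call: at the starting point the one of the given
  selection \<open>F'\<close>, at later iterates the one built from the subgradient found in the step.\<close>

definition iter_gradient ::
    "((real^'n) \<Rightarrow> real) \<Rightarrow> ((real^'n) \<Rightarrow> real^'n) \<Rightarrow> (real^'n) call \<Rightarrow> nat \<Rightarrow> real^'n" where
  "iter_gradient f F' c t =
     (if t = 0 then F' (iter c 0) else gradient f (iter c t) + subgr c t)"

text \<open>The infimum of the empty set is \<open>\<infinity>\<close>.\<close>

definition first_hit ::
    "((real^'n) \<Rightarrow> real) \<Rightarrow> ((real^'n) \<Rightarrow> real^'n) \<Rightarrow> real \<Rightarrow>
     (nat \<Rightarrow> nat \<Rightarrow> (real^'n) call) \<Rightarrow> enat" where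
  "first_hit f F' \<epsilon> C =
     Inf {enat k | k. \<exists>l t. executed C k l \<and> t \<le> steps (C k l) \<and>
                          norm (iter_gradient f F' (C k l) t) \<le> \<epsilon>}"

definition rate_const :: "real \<Rightarrow> real \<Rightarrow> real \<Rightarrow> nat \<Rightarrow> real" where
  "rate_const \<mu> L \<tau>0 m =
     (let c = 1 / (3 powr (1/6) * 2 powr (13/6))
      in \<mu>\<^sup>2 / 2 * inverse (3 * 2 ^ 6 * (2/3) powr (1/3) * real m * max \<tau>0 L + 8 * L
                            + c\<^sup>2 * L\<^sup>2 * real m / \<tau>0))"

definition grad_const :: real where
  "grad_const = 1 / (3 powr (1/3) * 2\<^sup>2 * (2/3) powr (1/6))"

end

theory Submission
  imports Defs
begin

text \<open>
  Write \<open>G\<close> for the norm of the composite gradient at the starting point of an outer iteration,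
  taken with the subgradient that certified this point rather than with the given selection.
  While all composite gradients exceed \<open>\<epsilon>\<close>, the finite difference errors are dominated: the gradient
  error is at most \<open>\<epsilon> / 4\<close>, and the Hessian error times the step length \<open>r\<close> is at most
  \<open>\<epsilon> / 4\<close> plus a multiple of \<open>r\<^sup>2\<close>. Strong monotonicity bounds \<open>r\<close> by the current gradient norm over
  \<open>\<mu>\<close>, and since the Hessian is frozen at the starting point, each inner step multiplies the
  gradient norm by at most \<open>G / \<kappa>\<close>. A successful call thus maps \<open>G / \<kappa>\<close> to at most
  \<open>(G / \<kappa>) ^ (m + 1)\<close>, and \<open>G / \<kappa> \<le> 1 / 2\<close> initially. A call cannot halt once the trial value is at
  least \<open>L\<close>: large gradients force long steps, and the cubic regularization turns those into
  the required decrease. So trial values never exceed \<open>2 max {\<tau>0, L}\<close>.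
\<close>

section \<open>Taylor estimates\<close>

lemma gradient_eqI:
  assumes "GDERIV f x :> D"
  shows "gradient f x = D"
proof -
  have "D' = D" if D': "GDERIV f x :> D'" for D'
  proof -
    have "(\<lambda>h. h \<bullet> D') = (\<lambda>h. h \<bullet> D)"
      using has_derivative_unique D' assms unfolding gderiv_def by blast
    then show "D' = D"
      by (metis vector_eq_rdot inner_commute)
  qed
  with assms show ?thesis
    unfolding gradient_def by blast
qed

text \<open>By Riesz representation, the vector is the value at 1 of the adjoint of the
  derivative.\<close>

lemma GDERIV_gradient:
  assumes "f differentiable (at x)"
  shows "GDERIV f x :> gradient f x"
proof -
  obtain f' where f': "(f has_derivative f') (at x)"
    using assms differentiable_def by blast
  then have "linear f'"
    using has_derivative_linear by blast
  then have "f' = (\<lambda>h. h \<bullet> adjoint f' 1)"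
    using adjoint_works[of f' _ 1] by (auto simp: fun_eq_iff)
  then have "GDERIV f x :> adjoint f' 1"
    using f' unfolding gderiv_def by simp
  then show ?thesis
    using gradient_eqI by metis
qed

text \<open>This replaces integration of a remainder: the primitive of \<open>K * s ^ p\<close>
  minus \<open>\<phi>\<close> has nonnegative derivative on the unit interval. It is used with
  \<open>p = 1\<close> and \<open>p = 2\<close>.\<close>

lemma DERIV_le_power_imp_le:
  fixes \<phi> \<phi>' :: "real \<Rightarrow> real"
  assumes "\<And>s. 0 \<le> s \<Longrightarrow> s \<le> 1 \<Longrightarrow> (\<phi> has_real_derivative \<phi>' s) (at s)"
    and "\<And>s. 0 \<le> s \<Longrightarrow> s \<le> 1 \<Longrightarrow> \<phi>' s \<le> K * s ^ p"
  shows "\<phi> 1 - \<phi> 0 \<le> K / real (Suc p)"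
proof -
  let ?g = "\<lambda>s. K / real (Suc p) * s ^ Suc p - \<phi> s"
  have "?g 0 \<le> ?g 1"
  proof (rule DERIV_nonneg_imp_nondecreasing[of 0 1 ?g])
    fix s :: real
    assume s: "0 \<le> s" "s \<le> 1"
    have "(?g has_real_derivative K * s ^ p - \<phi>' s) (at s)"
      by (rule derivative_eq_intros assms(1) s refl)+
        (auto simp: field_simps simp del: of_nat_Suc)
    then show "\<exists>y. (?g has_real_derivative y) (at s) \<and> 0 \<le> y"
      using assms(2)[OF s] by force
  qed simp
  then show ?thesis by simp
qed

lemma has_derivative_line: "((\<lambda>s. x + s *\<^sub>R d) has_derivative (\<lambda>t. t *\<^sub>R d)) (at s)"
  by (auto intro!: derivative_eq_intros)

locale lipschitz_hessian =
  fixes f :: "real^'n \<Rightarrow> real" and L :: real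
  assumes smooth: "twice_cont_diff f"
    and hessian_lipschitz:
      "\<And>y z. spectral_norm (hessian f z - hessian f y) \<le> L * norm (z - y)"
    and L_nonneg: "0 \<le> L"
begin

lemma has_derivative_f: "(f has_derivative (\<lambda>h. h \<bullet> gradient f x)) (at x)"
  using GDERIV_gradient smooth unfolding twice_cont_diff_def gderiv_def by blast

lemma has_derivative_gradient: "(gradient f has_derivative (*v) (hessian f x)) (at x)"
  using smooth jacobian_works unfolding twice_cont_diff_def hessian_def by blast

lemma norm_hessian_diff_le:
  "norm ((hessian f z - hessian f y) *v v) \<le> L * norm (z - y) * norm v"
proof -
  have "norm ((hessian f z - hessian f y) *v v)
      \<le> spectral_norm (hessian f z - hessian f y) * norm v"
    unfolding spectral_norm_def by (rule onorm) simp
  also have "\<dots> \<le> L * norm (z - y) * norm v"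
    by (intro mult_right_mono hessian_lipschitz) simp
  finally show ?thesis .
qed

lemma DERIV_f_line:
  "((\<lambda>s. f (x + s *\<^sub>R d)) has_real_derivative d \<bullet> gradient f (x + s *\<^sub>R d)) (at s)"
proof -
  have "((\<lambda>s. f (x + s *\<^sub>R d)) has_derivative (\<lambda>t. (t *\<^sub>R d) \<bullet> gradient f (x + s *\<^sub>R d))) (at s)"
    by (rule has_derivative_compose[OF has_derivative_line has_derivative_f])
  then show ?thesis
    unfolding has_field_derivative_def
    by (rule has_derivative_eq_rhs) (simp add: fun_eq_iff)
qed

lemma DERIV_gradient_line:
  "((\<lambda>s. gradient f (x + s *\<^sub>R d) \<bullet> w) has_real_derivative
     (hessian f (x + s *\<^sub>R d) *v d) \<bullet> w) (at s)"
proof -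
  have "((\<lambda>s. gradient f (x + s *\<^sub>R d)) has_derivative
      (\<lambda>t. hessian f (x + s *\<^sub>R d) *v (t *\<^sub>R d))) (at s)"
    by (rule has_derivative_compose[OF has_derivative_line has_derivative_gradient])
  then have "((\<lambda>s. gradient f (x + s *\<^sub>R d) \<bullet> w) has_derivative
      (\<lambda>t. (hessian f (x + s *\<^sub>R d) *v (t *\<^sub>R d)) \<bullet> w)) (at s)"
    by (rule has_derivative_inner_left)
  then show ?thesis
    unfolding has_field_derivative_def
    by (rule has_derivative_eq_rhs) (simp add: fun_eq_iff matrix_vector_mult_scaleR)
qed

text \<open>The vector remainder is reduced to one variable by pairing the gradient along the
  segment with the remainder itself. This gives its squared norm bounded by a constant times its
  norm, and one factor cancels.\<close>

lemma gradient_taylor: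
  "norm (gradient f (x + d) - gradient f x - hessian f x *v d) \<le> L / 2 * (norm d)\<^sup>2"
proof -
  define w where "w = gradient f (x + d) - gradient f x - hessian f x *v d"
  define \<phi> where "\<phi> s = gradient f (x + s *\<^sub>R d) \<bullet> w - s * ((hessian f x *v d) \<bullet> w)" for s
  have "\<phi> 1 - \<phi> 0 \<le> L * (norm d)\<^sup>2 * norm w / real (Suc 1)"
  proof (rule DERIV_le_power_imp_le)
    fix s :: real
    assume s: "0 \<le> s" "s \<le> 1"
    show "(\<phi> has_real_derivative ((hessian f (x + s *\<^sub>R d) - hessian f x) *v d) \<bullet> w) (at s)"
      unfolding \<phi>_def
      by (rule derivative_eq_intros DERIV_gradient_line refl)+
        (simp add: matrix_vector_mult_diff_rdistrib inner_diff_left)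
    have "((hessian f (x + s *\<^sub>R d) - hessian f x) *v d) \<bullet> w
        \<le> norm ((hessian f (x + s *\<^sub>R d) - hessian f x) *v d) * norm w"
      by (rule norm_cauchy_schwarz)
    also have "\<dots> \<le> L * norm (x + s *\<^sub>R d - x) * norm d * norm w"
      by (intro mult_right_mono norm_hessian_diff_le) simp
    finally show "((hessian f (x + s *\<^sub>R d) - hessian f x) *v d) \<bullet> w
        \<le> L * (norm d)\<^sup>2 * norm w * s ^ 1"
      using s by (simp add: power2_eq_square mult_ac)
  qed
  moreover have "\<phi> 1 - \<phi> 0 = norm w * norm w"
    unfolding \<phi>_def w_def by (simp add: inner_diff_left power2_norm_eq_inner flip: power2_eq_square)
  ultimately have "norm w * norm w \<le> (L / 2 * (norm d)\<^sup>2) * norm w"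
    by simp
  then have "norm w \<le> L / 2 * (norm d)\<^sup>2"
    using L_nonneg by (cases "norm w = 0") (auto simp: mult_le_cancel_right)
  then show ?thesis
    unfolding w_def .
qed

text \<open>The sign \<open>c\<close> treats the upper and the lower estimate at once. The
  derivative along the segment is the gradient remainder paired with \<open>d\<close>, of size
  \<open>L / 2 * norm d ^ 3 * s ^ 2\<close>, and integrating yields the factor 1/6.\<close>

lemma taylor_upper:
  assumes "\<bar>c\<bar> = 1"
  shows "c * (f (x + d) - f x - gradient f x \<bullet> d - 1/2 * ((hessian f x *v d) \<bullet> d))
           \<le> L / 6 * norm d ^ 3"
proof -
  define \<phi> where "\<phi> s = c * (f (x + s *\<^sub>R d) - s * (gradient f x \<bullet> d)
      - s\<^sup>2 * (1/2 * ((hessian f x *v d) \<bullet> d)))" for s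
  have "\<phi> 1 - \<phi> 0 \<le> L / 2 * norm d ^ 3 / real (Suc 2)"
  proof (rule DERIV_le_power_imp_le)
    fix s :: real
    assume s: "0 \<le> s" "s \<le> 1"
    let ?w = "gradient f (x + s *\<^sub>R d) - gradient f x - hessian f x *v (s *\<^sub>R d)"
    show "(\<phi> has_real_derivative c * (?w \<bullet> d)) (at s)"
      unfolding \<phi>_def
      by (rule derivative_eq_intros DERIV_f_line refl)+
        (simp add: inner_diff_left inner_diff_right inner_commute matrix_vector_mult_scaleR)
    have "c * (?w \<bullet> d) \<le> \<bar>c\<bar> * \<bar>?w \<bullet> d\<bar>"
      by (metis abs_ge_self abs_mult)
    also have "\<dots> \<le> norm ?w * norm d"
      using assms Cauchy_Schwarz_ineq2[of ?w d] by simp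
    also have "\<dots> \<le> L / 2 * (norm (s *\<^sub>R d))\<^sup>2 * norm d"
      by (intro mult_right_mono gradient_taylor) simp
    finally show "c * (?w \<bullet> d) \<le> L / 2 * norm d ^ 3 * s ^ 2"
      by (simp add: power_mult_distrib power2_eq_square power3_eq_cube mult_ac)
  qed
  then show ?thesis
    unfolding \<phi>_def by (simp add: algebra_simps)
qed

lemma taylor_second_order:
  "\<bar>f (x + d) - f x - gradient f x \<bullet> d - 1/2 * ((hessian f x *v d) \<bullet> d)\<bar> \<le> L / 6 * norm d ^ 3"
proof -
  have *: "\<bar>a\<bar> \<le> b" if "1 * a \<le> b" "-1 * a \<le> b" for a b :: real
    using that by linarith
  show ?thesis
    by (rule *; rule taylor_upper) simp_all
qed

end

section \<open>Finite differences\<close>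

lemma norm_le_sqrt_card:
  fixes v :: "real^'n"
  assumes "\<And>i. \<bar>v $ i\<bar> \<le> c"
  shows "norm v \<le> sqrt (real CARD('n)) * c"
proof -
  have c: "0 \<le> c"
    using assms abs_ge_zero order_trans by blast
  have "(norm v)\<^sup>2 = (\<Sum>i\<in>UNIV. \<bar>v $ i\<bar>\<^sup>2)"
    by (simp add: norm_vec_def L2_set_def sum_nonneg)
  also have "\<dots> \<le> (\<Sum>i\<in>(UNIV::'n set). c\<^sup>2)"
    by (intro sum_mono power_mono assms) simp
  also have "\<dots> = (sqrt (real CARD('n)) * c)\<^sup>2"
    by (simp add: power_mult_distrib)
  finally show ?thesis
    by (rule power2_le_imp_le) (use c in simp)
qed

text \<open>Cauchy-Schwarz on each row costs one square root of the dimension, collecting the rows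
  costs the other.\<close>

lemma norm_matrix_vector_mult_le:
  fixes A :: "real^'n^'n"
  assumes "\<And>i j. \<bar>A $ i $ j\<bar> \<le> c"
  shows "norm (A *v v) \<le> real CARD('n) * c * norm v"
proof -
  have "\<bar>(A *v v) $ i\<bar> \<le> sqrt (real CARD('n)) * c * norm v" for i
  proof -
    have "\<bar>(A *v v) $ i\<bar> \<le> norm (A $ i) * norm v"
      by (simp add: matrix_vector_mul_component Cauchy_Schwarz_ineq2)
    also have "\<dots> \<le> sqrt (real CARD('n)) * c * norm v"
      by (intro mult_right_mono norm_le_sqrt_card assms) simp
    finally show ?thesis .
  qed
  then have "norm (A *v v) \<le> sqrt (real CARD('n)) * (sqrt (real CARD('n)) * c * norm v)"
    by (rule norm_le_sqrt_card)
  also have "\<dots> = (sqrt (real CARD('n)) * sqrt (real CARD('n))) * c * norm v"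
    by (simp only: mult.assoc)
  finally show ?thesis
    by simp
qed

context lipschitz_hessian
begin

text \<open>Central differences cancel the quadratic Taylor term \<open>q\<close>, so only two cubic
  remainders of size \<open>L / 6 * h ^ 3\<close> survive. Division by \<open>2 * h\<close> leaves
  second order in \<open>h\<close>.\<close>

lemma fd_gradient_error:
  assumes "0 < h"
  shows "norm (fd_gradient f h x - gradient f x) \<le> sqrt (real CARD('n)) * (L / 6 * h\<^sup>2)"
proof (rule norm_le_sqrt_card)
  fix i :: 'n
  let ?d = "h *\<^sub>R axis i 1"
  have "\<bar>f (x + ?d) - f (x - ?d) - 2 * h * gradient f x $ i\<bar> \<le> L / 3 * h ^ 3"
  proof -
    define q where "q = 1/2 * ((hessian f x *v ?d) \<bullet> ?d)"
    have "1/2 * ((hessian f x *v (- ?d)) \<bullet> (- ?d)) = q"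
      by (simp add: q_def linear_neg[OF matrix_vector_mul_linear])
    then have "\<bar>f (x - ?d) - f x + gradient f x \<bullet> ?d - q\<bar> \<le> L / 6 * h ^ 3"
      using taylor_second_order[of x "- ?d"] assms by simp
    moreover have "\<bar>f (x + ?d) - f x - gradient f x \<bullet> ?d - q\<bar> \<le> L / 6 * h ^ 3"
      using taylor_second_order[of x ?d] assms by (simp add: q_def)
    moreover have "gradient f x \<bullet> ?d = h * gradient f x $ i"
      by (simp add: inner_axis)
    ultimately show ?thesis
      by linarith
  qed
  then have "\<bar>f (x + ?d) - f (x - ?d) - 2 * h * gradient f x $ i\<bar> / (2 * h) \<le> L / 3 * h ^ 3 / (2 * h)"
    by (rule divide_right_mono) (use assms in simp)
  moreover have "(fd_gradient f h x - gradient f x) $ i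
      = (f (x + ?d) - f (x - ?d) - 2 * h * gradient f x $ i) / (2 * h)"
    using assms by (simp add: fd_gradient_def field_simps)
  ultimately show "\<bar>(fd_gradient f h x - gradient f x) $ i\<bar> \<le> L / 6 * h\<^sup>2"
    using assms by (simp add: abs_divide power2_eq_square power3_eq_cube)
qed

text \<open>The second difference is a first difference of \<open>\<phi>\<close>, so the mean value
  theorem turns it into \<open>h\<close> times a difference of directional derivatives at an
  intermediate point. Expanding the gradient there contributes \<open>L / 2 * h\<close>, and moving
  the Hessian back to \<open>x\<close> contributes at most \<open>L * h\<close>.\<close>

lemma fd_matrix_error:
  assumes h: "0 < h"
  shows "\<bar>(fd_matrix f h x - hessian f x) $ i $ j\<bar> \<le> 3 / 2 * L * h"
proof -
  define H where "H = hessian f x $ i $ j"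
  let ?a = "axis i 1 :: real^'n" and ?b = "axis j 1 :: real^'n"
  define \<phi> where "\<phi> s = f ((x + h *\<^sub>R ?b) + s *\<^sub>R ?a) - f (x + s *\<^sub>R ?a)" for s
  define \<phi>' where "\<phi>' s = ?a \<bullet> gradient f ((x + h *\<^sub>R ?b) + s *\<^sub>R ?a)
      - ?a \<bullet> gradient f (x + s *\<^sub>R ?a)" for s
  have "(\<phi> has_real_derivative \<phi>' s) (at s)" for s
    unfolding \<phi>_def \<phi>'_def by (intro DERIV_diff DERIV_f_line)
  then obtain s where s: "0 < s" "s < h" "\<phi> h - \<phi> 0 = (h - 0) * \<phi>' s"
    using MVT2[OF h, of \<phi> \<phi>'] by blast
  let ?z = "x + s *\<^sub>R ?a"
  have H: "(hessian f x *v ?b) \<bullet> ?a = H"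
    by (simp add: H_def inner_axis matrix_vector_mul_component inner_axis')
  have "\<phi>' s - h * H = (gradient f (?z + h *\<^sub>R ?b) - gradient f ?z - hessian f ?z *v (h *\<^sub>R ?b)) \<bullet> ?a
      + h * (((hessian f ?z - hessian f x) *v ?b) \<bullet> ?a)"
    unfolding \<phi>'_def H[symmetric]
    by (simp add: inner_commute matrix_vector_mult_scaleR matrix_vector_mult_diff_rdistrib
        algebra_simps)
  also have "\<bar>\<dots>\<bar> \<le> L / 2 * h\<^sup>2 + h * (L * s)"
  proof (rule order_trans[OF abs_triangle_ineq add_mono])
    show "\<bar>(gradient f (?z + h *\<^sub>R ?b) - gradient f ?z - hessian f ?z *v (h *\<^sub>R ?b)) \<bullet> ?a\<bar>
        \<le> L / 2 * h\<^sup>2"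
      using gradient_taylor[of ?z "h *\<^sub>R ?b"] h by (intro order_trans[OF Cauchy_Schwarz_ineq2]) simp
    have "\<bar>((hessian f ?z - hessian f x) *v ?b) \<bullet> ?a\<bar> \<le> L * s"
      using norm_hessian_diff_le[of ?z x ?b] s by (intro order_trans[OF Cauchy_Schwarz_ineq2]) simp
    then show "\<bar>h * (((hessian f ?z - hessian f x) *v ?b) \<bullet> ?a)\<bar> \<le> h * (L * s)"
      using h by (simp add: abs_mult)
  qed
  also have "\<dots> \<le> 3 / 2 * L * h * h"
    using mult_left_mono[of s h "h * L"] s h L_nonneg by (simp add: power2_eq_square algebra_simps)
  finally have "\<bar>\<phi>' s - h * H\<bar> / h \<le> 3 / 2 * L * h"
    using h by (simp add: divide_le_eq)
  moreover have "(fd_matrix f h x - hessian f x) $ i $ j = (\<phi>' s - h * H) / h"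
  proof -
    have "(fd_matrix f h x) $ i $ j = (\<phi> h - \<phi> 0) / h\<^sup>2"
      by (simp add: fd_matrix_def \<phi>_def algebra_simps)
    then show ?thesis
      using s(3) h by (simp add: H_def power2_eq_square field_simps)
  qed
  ultimately show ?thesis
    using h by (simp add: abs_divide)
qed

text \<open>Exchanging \<open>i\<close> and \<open>j\<close> permutes the terms of the second
  difference, so the entrywise error bound for \<open>fd_matrix\<close> carries over.\<close>

lemma fd_hessian_eq: "fd_hessian f h x = fd_matrix f h x"
proof -
  have "transpose (fd_matrix f h x) = fd_matrix f h x"
  proof -
    have "fd_matrix f h x $ j $ i = fd_matrix f h x $ i $ j" for i j
    proof -
      have "f (x + h *\<^sub>R axis j 1 + h *\<^sub>R axis i 1) = f (x + h *\<^sub>R axis i 1 + h *\<^sub>R axis j 1)"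
        by (metis add.assoc add.commute)
      then show ?thesis
        unfolding fd_matrix_def vec_lambda_beta
        by (intro arg_cong[of _ _ "\<lambda>u. u / h\<^sup>2"]) linarith
    qed
    then show ?thesis
      by (simp add: transpose_def vec_eq_iff)
  qed
  then show ?thesis
    unfolding fd_hessian_def by (simp only: scaleR_half_double)
qed

lemma fd_hessian_error:
  assumes "0 < h"
  shows "norm ((fd_hessian f h x - hessian f x) *v v) \<le> real CARD('n) * (3 / 2 * L * h) * norm v"
  unfolding fd_hessian_eq by (intro norm_matrix_vector_mult_le fd_matrix_error assms)

end

section \<open>Inexact cubic steps\<close>

text \<open>Away from \<open>x\<close> this is the chain rule. At \<open>x\<close>, where the norm
  is not differentiable, the difference quotient of the cube is the squared distance, which tends to
  0.\<close>

lemma GDERIV_norm_cube: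
  fixes x y :: "'a::real_inner"
  shows "GDERIV (\<lambda>y. norm (y - x) ^ 3) y :> (3 * norm (y - x)) *\<^sub>R (y - x)"
proof (cases "y = x")
  case False
  have "((\<lambda>y. norm (y - x)) has_derivative (\<lambda>h. h \<bullet> sgn (y - x))) (at y)"
  proof (rule has_derivative_compose[of "\<lambda>y. y - x" "\<lambda>h. h"])
    show "((\<lambda>y. y - x) has_derivative (\<lambda>h. h)) (at y)"
      by (auto intro!: derivative_eq_intros)
    show "(norm has_derivative (\<lambda>h. h \<bullet> sgn (y - x))) (at (y - x))"
      using False by (intro has_derivative_norm) simp
  qed
  then have "((\<lambda>y. norm (y - x) ^ 3) has_derivative
      (\<lambda>h. of_nat 3 * (h \<bullet> sgn (y - x)) * norm (y - x) ^ (3 - 1))) (at y)"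
    by (rule has_derivative_power)
  then show ?thesis
    unfolding gderiv_def
    by (rule has_derivative_eq_rhs)
      (use False in \<open>simp add: fun_eq_iff sgn_div_norm power2_eq_square divide_inverse\<close>)
next
  case True
  have "((\<lambda>z. norm (z - x) ^ 2) \<longlongrightarrow> norm (x - x) ^ 2) (at x)"
    by (intro tendsto_intros)
  moreover have "(\<lambda>z. norm (z - x) ^ 3 / norm (z - x)) = (\<lambda>z. norm (z - x) ^ 2)"
    by (simp add: fun_eq_iff power2_eq_square power3_eq_cube)
  ultimately have "((\<lambda>z. norm (z - x) ^ 3 / norm (z - x)) \<longlongrightarrow> 0) (at x)"
    by simp
  then show ?thesis
    unfolding gderiv_def True has_derivative_at2
    by (simp add: bounded_linear_zero power_abs divide_inverse mult.commute)
qed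

lemma gradient_cubic_model:
  fixes B :: "real^'n^'n"
  assumes "transpose B = B"
  shows "gradient (cubic_model f g B \<sigma> x) y
           = g + B *v (y - x) + (\<sigma> / 2 * norm (y - x)) *\<^sub>R (y - x)"
proof (rule gradient_eqI)
  \<comment> \<open>Symmetry of \<open>B\<close> merges the two halves of the derivative of the
    quadratic form into one term.\<close>
  have "(B *v a) \<bullet> b = (B *v b) \<bullet> a" for a b
    using dot_lmul_matrix[of a B b] assms
    by (simp add: inner_commute transpose_matrix_vector flip: transpose_matrix_vector)
  note sym = this
  have cube: "((\<lambda>y. norm (y - x) ^ 3) has_derivative
      (\<lambda>h. h \<bullet> ((3 * norm (y - x)) *\<^sub>R (y - x)))) (at y)"
    using GDERIV_norm_cube unfolding gderiv_def .
  have lin: "((\<lambda>y. y - x) has_derivative (\<lambda>h. h)) (at y)"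
    by (auto intro!: derivative_eq_intros)
  have quad: "((\<lambda>y. (B *v (y - x)) \<bullet> (y - x)) has_derivative
      (\<lambda>h. (B *v (y - x)) \<bullet> h + (B *v h) \<bullet> (y - x))) (at y)"
    by (intro has_derivative_inner lin
        bounded_linear.has_derivative[OF matrix_vector_mul_bounded_linear])
  have "((\<lambda>y. f x + g \<bullet> (y - x) + 1/2 * ((B *v (y - x)) \<bullet> (y - x)) + \<sigma> / 6 * norm (y - x) ^ 3)
      has_derivative (\<lambda>h. 0 + g \<bullet> h + 1/2 * ((B *v (y - x)) \<bullet> h + (B *v h) \<bullet> (y - x))
        + \<sigma> / 6 * (h \<bullet> ((3 * norm (y - x)) *\<^sub>R (y - x))))) (at y)"
    by (intro has_derivative_add has_derivative_const has_derivative_mult_right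
        has_derivative_inner_right lin quad cube)
  then show "GDERIV (cubic_model f g B \<sigma> x) y
      :> g + B *v (y - x) + (\<sigma> / 2 * norm (y - x)) *\<^sub>R (y - x)"
    unfolding gderiv_def cubic_model_def[abs_def]
    by (rule has_derivative_eq_rhs)
      (simp add: fun_eq_iff sym[of _ "y - x"] inner_add_right inner_commute)
qed

lemma transpose_fd_hessian: "transpose (fd_hessian f h x) = fd_hessian f h x"
  by (simp add: fd_hessian_def transpose_def vec_eq_iff)

section \<open>Subgradients and curvature in terms of real numbers\<close>

lemma edom_real:
  assumes "\<And>y. \<psi> y \<noteq> -\<infinity>" "x \<in> edom \<psi>"
  shows "\<psi> x = ereal (real_of_ereal (\<psi> x))"
  using assms unfolding edom_def by (cases "\<psi> x") auto

lemma subdiffD: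
  assumes "\<And>y. \<psi> y \<noteq> -\<infinity>" "s \<in> subdiff \<psi> x" "y \<in> edom \<psi>"
  shows "real_of_ereal (\<psi> x) + s \<bullet> (y - x) \<le> real_of_ereal (\<psi> y)"
proof -
  have x: "x \<in> edom \<psi>" and le: "\<psi> x + ereal (s \<bullet> (y - x)) \<le> \<psi> y"
    using assms(2) unfolding subdiff_def by auto
  obtain a b where "\<psi> x = ereal a" "\<psi> y = ereal b"
    using edom_real[OF assms(1) x] edom_real[OF assms(1,3)] by blast
  with le show ?thesis
    by simp
qed

lemma psd_diff_scaled_id:
  fixes A :: "real^'n^'n"
  assumes "psd (A - \<mu> *\<^sub>R mat 1)"
  shows "\<mu> * (norm v)\<^sup>2 \<le> (A *v v) \<bullet> v"
proof -
  have "0 \<le> v \<bullet> ((A - \<mu> *\<^sub>R mat 1) *v v)"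
    using assms unfolding psd_def by blast
  then show ?thesis
    by (simp add: matrix_vector_mult_diff_rdistrib inner_diff_right inner_commute
        scaleR_matrix_vector_assoc[symmetric] power2_norm_eq_inner)
qed

context lipschitz_hessian
begin

context
  fixes \<psi> :: "real^'n \<Rightarrow> ereal" and B :: "real^'n^'n" and \<sigma> \<epsilon> eg eB D :: real and m :: nat
    and x x' s z :: "real^'n"
  assumes step: "cubic_step f \<psi> B \<sigma> m \<epsilon> x x' s"
    and sym: "transpose B = B"
    and gradient_error:
      "norm (fd_gradient f (grad_stepsize CARD('n) \<sigma> m \<epsilon>) x - gradient f x) \<le> eg"
    and hessian_error: "\<And>v. norm ((B - hessian f z) *v v) \<le> eB * norm v"
    and dist_le: "norm (x - z) \<le> D"
begin

abbreviation (input) "d \<equiv> x' - x"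
abbreviation (input) "g \<equiv> fd_gradient f (grad_stepsize CARD('n) \<sigma> m \<epsilon>) x"

text \<open>The matrix \<open>B\<close> was built at \<open>z\<close> but is used at
  \<open>x\<close>. The Lipschitz condition charges \<open>L * D\<close> for the distance between
  the two points.\<close>

lemma hessian_error_at: "norm ((B - hessian f x) *v v) \<le> (L * D + eB) * norm v"
proof -
  have "(B - hessian f x) *v v = (B - hessian f z) *v v - (hessian f x - hessian f z) *v v"
    by (simp add: matrix_vector_mult_diff_rdistrib)
  also have "norm \<dots> \<le> eB * norm v + L * norm (x - z) * norm v"
    by (rule order_trans[OF norm_triangle_ineq4 add_mono[OF hessian_error norm_hessian_diff_le]])
  also have "L * norm (x - z) * norm v \<le> L * D * norm v"
    by (intro mult_right_mono mult_left_mono dist_le L_nonneg) simp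
  finally show ?thesis
    by (simp add: algebra_simps)
qed

lemma model_gradient_bound:
  "norm (g + B *v d + (\<sigma> / 2 * norm d) *\<^sub>R d + s) \<le> \<sigma> / 4 * (norm d)\<^sup>2"
  using step sym unfolding cubic_step_def Let_def by (simp add: gradient_cubic_model)

text \<open>The new composite gradient is the model gradient plus a Taylor remainder, the two
  difference errors and the gradient of the cubic term. The coefficient 3/4 collects 1/4 from the
  inexactness of the step and 1/2 from the cubic term.\<close>

lemma cubic_step_gradient_bound:
  assumes "0 < \<sigma>"
  shows "norm (gradient f x' + s)
    \<le> (3/4 * \<sigma> + L / 2) * (norm d)\<^sup>2 + eg + (L * D + eB) * norm d"
proof -
  have "gradient f x' + s = (g + B *v d + (\<sigma> / 2 * norm d) *\<^sub>R d + s)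
      + ((gradient f (x + d) - gradient f x - hessian f x *v d)
      - (g - gradient f x) - (B - hessian f x) *v d - (\<sigma> / 2 * norm d) *\<^sub>R d)"
    by (simp add: matrix_vector_mult_diff_rdistrib)
  also have "norm \<dots> \<le> \<sigma> / 4 * (norm d)\<^sup>2
      + (L / 2 * (norm d)\<^sup>2 + eg + (L * D + eB) * norm d + \<sigma> / 2 * norm d * norm d)"
    using assms
    by (intro norm_triangle_le norm_triangle_le_diff add_mono model_gradient_bound gradient_taylor
        gradient_error hessian_error_at) simp
  finally show ?thesis
    by (simp add: power2_eq_square algebra_simps)
qed

text \<open>The step may not raise the model above the old objective, and the model differs from
  \<open>f\<close> at \<open>x'\<close> by the difference errors and a Taylor remainder. That
  remainder takes \<open>L / 6\<close> from the cubic coefficient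
  \<open>\<sigma> / 6\<close>.\<close>

lemma cubic_step_decrease:
  assumes psi: "\<And>y. \<psi> y \<noteq> -\<infinity>" and x: "x \<in> edom \<psi>"
  shows "f x' + real_of_ereal (\<psi> x') \<le> f x + real_of_ereal (\<psi> x)
    + eg * norm d + 1/2 * (L * D + eB) * (norm d)\<^sup>2 - (\<sigma> - L) / 6 * norm d ^ 3"
proof -
  have x': "x' \<in> edom \<psi>"
    and "ereal (cubic_model f g B \<sigma> x x') + \<psi> x' \<le> objective f \<psi> x"
    using step unfolding cubic_step_def Let_def by auto
  then have "cubic_model f g B \<sigma> x x' + real_of_ereal (\<psi> x') \<le> f x + real_of_ereal (\<psi> x)"
    unfolding objective_def by (subst (asm) (1 2) edom_real[OF psi]) (use x x' in auto)
  moreover have "f (x + d) - f x - gradient f x \<bullet> d - 1/2 * ((hessian f x *v d) \<bullet> d)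
      \<le> L / 6 * norm d ^ 3"
    using taylor_second_order[of x d] by linarith
  moreover have "gradient f x \<bullet> d - g \<bullet> d \<le> eg * norm d"
  proof -
    have "gradient f x \<bullet> d - g \<bullet> d \<le> \<bar>(g - gradient f x) \<bullet> d\<bar>"
      by (simp add: inner_diff_left)
    also have "\<dots> \<le> eg * norm d"
      by (rule order_trans[OF Cauchy_Schwarz_ineq2 mult_right_mono[OF gradient_error]]) simp
    finally show ?thesis .
  qed
  moreover have "(hessian f x *v d) \<bullet> d - (B *v d) \<bullet> d \<le> (L * D + eB) * (norm d)\<^sup>2"
  proof -
    have "(hessian f x *v d) \<bullet> d - (B *v d) \<bullet> d \<le> \<bar>((B - hessian f x) *v d) \<bullet> d\<bar>"
      by (simp add: inner_diff_left matrix_vector_mult_diff_rdistrib)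
    also have "\<dots> \<le> (L * D + eB) * norm d * norm d"
      by (rule order_trans[OF Cauchy_Schwarz_ineq2 mult_right_mono[OF hessian_error_at]]) simp
    finally show ?thesis
      by (simp add: power2_eq_square mult.assoc)
  qed
  ultimately show ?thesis
    unfolding cubic_model_def by (simp add: field_simps)
qed

text \<open>The near-stationarity condition is tested against the step \<open>d\<close>. Curvature
  is taken from the Hessian at \<open>z\<close>, the point where \<open>B\<close> was built, so no
  term with \<open>D\<close> enters. The inexactness uses up half of the cubic contribution
  \<open>\<sigma> / 2\<close>.\<close>

lemma cubic_step_length_bound:
  assumes psi: "\<And>y. \<psi> y \<noteq> -\<infinity>" and s0: "s0 \<in> subdiff \<psi> x"
    and convex: "psd (hessian f z - \<mu> *\<^sub>R mat 1)"
  shows "(\<mu> - eB) * (norm d)\<^sup>2 + \<sigma> / 4 * norm d ^ 3 \<le> (norm (gradient f x + s0) + eg) * norm d"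
proof -
  have s: "s \<in> subdiff \<psi> x'"
    using step unfolding cubic_step_def Let_def by auto
  have "x \<in> edom \<psi>" "x' \<in> edom \<psi>"
    using s s0 unfolding subdiff_def by auto
  \<comment> \<open>Adding the two subgradient inequalities gives monotonicity of the
    subdifferential.\<close>
  then have mono: "0 \<le> (s - s0) \<bullet> d"
    using subdiffD[OF psi s0, of x'] subdiffD[OF psi s, of x]
    by (simp add: inner_diff_left inner_diff_right)
  have "(g + B *v d + (\<sigma> / 2 * norm d) *\<^sub>R d + s) \<bullet> d \<le> \<sigma> / 4 * (norm d)\<^sup>2 * norm d"
    by (rule order_trans[OF norm_cauchy_schwarz mult_right_mono[OF model_gradient_bound]]) simp
  then have 1: "g \<bullet> d + (B *v d) \<bullet> d + \<sigma> / 2 * norm d ^ 3 + s \<bullet> d \<le> \<sigma> / 4 * norm d ^ 3"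
    by (simp add: inner_add_left power2_norm_eq_inner[symmetric] power2_eq_square power3_eq_cube
        mult.assoc)
  have "- ((B - hessian f z) *v d) \<bullet> d \<le> \<bar>((B - hessian f z) *v d) \<bullet> d\<bar>"
    by simp
  also have "\<dots> \<le> eB * norm d * norm d"
    by (rule order_trans[OF Cauchy_Schwarz_ineq2 mult_right_mono[OF hessian_error]]) simp
  finally have 2: "(hessian f z *v d) \<bullet> d - (B *v d) \<bullet> d \<le> eB * (norm d)\<^sup>2"
    by (simp add: matrix_vector_mult_diff_rdistrib inner_diff_left power2_eq_square mult.assoc)
  have "- (g - gradient f x + (gradient f x + s0)) \<bullet> d
      \<le> norm (g - gradient f x + (gradient f x + s0)) * norm d"
    by (metis norm_cauchy_schwarz norm_minus_cancel)
  also have "\<dots> \<le> (eg + norm (gradient f x + s0)) * norm d"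
    by (intro mult_right_mono norm_triangle_mono gradient_error) simp_all
  finally have 3: "- (g \<bullet> d) - s0 \<bullet> d \<le> (eg + norm (gradient f x + s0)) * norm d"
    by (simp add: inner_add_left inner_diff_left)
  show ?thesis
    using 1 2 3 mono psd_diff_scaled_id[OF convex, of d]
    by (simp add: inner_diff_left algebra_simps)
qed

end

end

section \<open>Parameters\<close>

lemma powr_third_cubed:
  fixes a :: real
  assumes "0 < a"
  shows "(a powr (1/3)) ^ 3 = a"
  using assms by (simp add: powr_powr flip: powr_realpow)

lemma cube_le_imp_le:
  fixes a b :: real
  assumes "a ^ 3 \<le> b ^ 3" "0 \<le> b"
  shows "a \<le> b"
  using assms power_le_imp_le_base[of a 2 b] by (simp add: numeral_3_eq_3)

text \<open>Rational enclosures, checked by comparing cubes, reduce all later comparisons of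
  constants to rational arithmetic.\<close>

lemma two_thirds_root_bounds: "87/100 \<le> (2/3::real) powr (1/3)" "(2/3::real) powr (1/3) \<le> 88/100"
  by (rule cube_le_imp_le; simp add: powr_third_cubed power_divide)+

lemma nine_root_bounds: "208/100 \<le> (9::real) powr (1/3)" "(9::real) powr (1/3) \<le> 209/100"
  by (rule cube_le_imp_le; simp add: powr_third_cubed power_divide)+

lemma cnm_sigma_bounds:
  assumes "0 \<le> \<theta>"
  shows "1392/100 * (\<theta> * real m) \<le> cnm_sigma m \<theta>" "cnm_sigma m \<theta> \<le> 1408/100 * (\<theta> * real m)"
proof -
  have "cnm_sigma m \<theta> = 16 * ((2/3) powr (1/3) * (\<theta> * real m))"
    by (simp add: cnm_sigma_def)
  moreover have "0 \<le> \<theta> * real m"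
    using assms by simp
  note mult_right_mono[OF two_thirds_root_bounds(1) this] mult_right_mono[OF two_thirds_root_bounds(2) this]
  ultimately show "1392/100 * (\<theta> * real m) \<le> cnm_sigma m \<theta>"
    and "cnm_sigma m \<theta> \<le> 1408/100 * (\<theta> * real m)"
    by linarith+
qed

lemma grad_const_square: "grad_const\<^sup>2 = 1 / (16 * (9 powr (1/3) * (2/3) powr (1/3)))"
proof -
  have "(3 powr (1/3))\<^sup>2 = (9::real) powr (1/3)"
    by (simp add: power2_eq_square flip: powr_mult)
  moreover have "((2/3::real) powr (1/6))\<^sup>2 = (2/3) powr (1/3)"
    by (simp add: power2_eq_square flip: powr_add)
  ultimately show ?thesis
    by (simp add: grad_const_def power_divide power_mult_distrib)
qed

lemma grad_const_square_bounds: "1/30 \<le> grad_const\<^sup>2" "grad_const\<^sup>2 \<le> 1/28"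
proof -
  have "16 * (208/100 * (87/100)) \<le> 16 * ((9::real) powr (1/3) * (2/3) powr (1/3))"
    by (intro mult_left_mono mult_mono two_thirds_root_bounds nine_root_bounds) auto
  moreover have "16 * ((9::real) powr (1/3) * (2/3) powr (1/3)) \<le> 16 * (209/100 * (88/100))"
    by (intro mult_left_mono mult_mono two_thirds_root_bounds nine_root_bounds) auto
  ultimately show "1/30 \<le> grad_const\<^sup>2" "grad_const\<^sup>2 \<le> 1/28"
    unfolding grad_const_square by (auto intro!: divide_left_mono simp: field_simps)
qed

section \<open>Finite difference step sizes\<close>

lemma grad_stepsize_pos:
  assumes "0 < \<epsilon>" "0 < \<sigma>" "1 \<le> m" "1 \<le> n"
  shows "0 < grad_stepsize n \<sigma> m \<epsilon>"
  using assms by (simp add: grad_stepsize_def)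

text \<open>With this step size the dimension and \<open>m\<close> cancel, so the gradient error
  depends only on \<open>\<epsilon>\<close>, \<open>L\<close> and the trial value.\<close>

lemma grad_stepsize_square:
  assumes "0 < \<epsilon>" "0 < \<theta>" "1 \<le> m" "1 \<le> n"
  shows "sqrt (real n) * (grad_stepsize n (cnm_sigma m \<theta>) m \<epsilon>)\<^sup>2 = grad_const\<^sup>2 * \<epsilon> / \<theta>"
proof -
  let ?w = "(2/3::real) powr (1/3)" and ?v = "(9::real) powr (1/3)"
  have v: "(3 powr (1/3))\<^sup>2 = ?v"
    by (simp add: power2_eq_square flip: powr_mult)
  have sq: "(a powr (1/2))\<^sup>2 = a" if "0 < a" for a :: real
    using that by (simp add: powr_half_sqrt)
  have pos: "0 < cnm_sigma m \<theta>"
    using assms by (simp add: cnm_sigma_def)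
  have "(grad_stepsize n (cnm_sigma m \<theta>) m \<epsilon>)\<^sup>2 = 1 / ?v * (\<epsilon> * real m / (cnm_sigma m \<theta> * sqrt (real n)))"
    unfolding grad_stepsize_def power_mult_distrib power_divide v
    using assms pos by (subst sq) (auto simp: powr_half_sqrt)
  also have "sqrt (real n) * \<dots> = \<epsilon> * real m / (?v * cnm_sigma m \<theta>)"
    using assms by simp
  also have "\<dots> = grad_const\<^sup>2 * \<epsilon> / \<theta>"
    using assms by (simp add: grad_const_square cnm_sigma_def)
  finally show ?thesis .
qed

lemma cnm_stepsize_pos:
  assumes "0 < \<epsilon>" "0 < \<theta>" "1 \<le> m" "1 \<le> n"
  shows "0 < cnm_stepsize n m \<epsilon> \<theta>"
  using assms by (simp add: cnm_stepsize_def cnm_sigma_def)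

text \<open>Cubing removes the outer root. The remaining constant 81 / (2^14 * 192) equals 27 /
  2^20, which lies below the cube of 3/100.\<close>

lemma cnm_stepsize_le:
  assumes "0 < \<epsilon>" "0 < \<theta>" "1 \<le> m" "1 \<le> n"
  shows "real n * cnm_stepsize n m \<epsilon> \<theta> \<le> 3/100 * (sqrt (cnm_sigma m \<theta> * \<epsilon>) / \<theta>)"
proof (rule cube_le_imp_le)
  define \<sigma> where "\<sigma> = cnm_sigma m \<theta>"
  have pos: "0 < \<sigma>"
    using assms by (simp add: \<sigma>_def cnm_sigma_def)
  have "\<sigma> powr (3/2) * \<epsilon> powr (3/2) = (\<sigma> * \<epsilon>) powr (1/2 * 3)"
    using pos assms by (simp add: powr_mult)
  also have "\<dots> = sqrt (\<sigma> * \<epsilon>) ^ 3"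
    using pos assms by (simp add: powr_half_sqrt[symmetric] powr_powr flip: powr_realpow)
  finally have *: "3 ^ 4 * \<sigma> powr (3/2) * \<epsilon> powr (3/2) = 81 * sqrt (\<sigma> * \<epsilon>) ^ 3"
    by simp
  have "(real n * cnm_stepsize n m \<epsilon> \<theta>) ^ 3
      = real n ^ 3 * (81 * sqrt (\<sigma> * \<epsilon>) ^ 3 / (2 ^ 14 * 192 * real n ^ 3 * \<theta> ^ 3))"
    unfolding power_mult_distrib cnm_stepsize_def \<sigma>_def[symmetric] *
    using pos assms by (subst powr_third_cubed) auto
  also have "\<dots> = 27 / 1048576 * (sqrt (\<sigma> * \<epsilon>) / \<theta>) ^ 3"
    using assms by (simp add: power_divide)
  also have "\<dots> \<le> (3/100) ^ 3 * (sqrt (\<sigma> * \<epsilon>) / \<theta>) ^ 3"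
    using pos assms by (intro mult_right_mono) (auto simp: power_divide)
  finally show "(real n * cnm_stepsize n m \<epsilon> \<theta>) ^ 3
      \<le> (3/100 * (sqrt (cnm_sigma m \<theta> * \<epsilon>) / \<theta>)) ^ 3"
    by (simp only: power_mult_distrib \<sigma>_def)
qed (use assms in \<open>simp add: cnm_sigma_def\<close>)

section \<open>Scalar recursions\<close>

text \<open>Each index below \<open>T\<close> belongs to \<open>T - 1\<close> pairs, so the double
  sum is at most \<open>c * (T - 1)\<close> times the sum of \<open>q\<close>. The subtracted term
  is kept on the left to make the induction direct.\<close>

lemma sum_prefix_product_le:
  fixes u :: "nat \<Rightarrow> real"
  assumes "\<And>i t. i < t \<Longrightarrow> t < T \<Longrightarrow> u i * p t \<le> c * (q i + q t)"
  shows "(\<Sum>t<T. (\<Sum>i<t. u i) * p t) + c * (\<Sum>t<T. q t) \<le> c * (real T * (\<Sum>t<T. q t))"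
  using assms
proof (induction T)
  case (Suc T)
  have "(\<Sum>i<T. u i) * p T \<le> (\<Sum>i<T. c * (q i + q T))"
    unfolding sum_distrib_right using Suc.prems by (intro sum_mono) auto
  also have "\<dots> = c * (\<Sum>t<T. q t) + c * (real T * q T)"
    by (simp add: sum.distrib algebra_simps flip: sum_distrib_left)
  finally show ?case
    using Suc by (simp add: algebra_simps)
qed simp

text \<open>The factor 1/10 is a multiplier: the gradient condition of \<open>total_decrease\<close>
  is later added with this weight. What remains is a cubic inequality that follows from two squares,
  with double roots near its tightest place.\<close>

lemma cubic_decrease_margin:
  fixes u :: real
  assumes "0 \<le> u"
  shows "1/384 + 1/10 * (83/100 * u\<^sup>2 + 45/1000 * u - 994/1000)
           \<le> 118/1000 * u ^ 3 - 6/1000 * u - 225/10000 * u\<^sup>2"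
proof -
  have "0 \<le> u * (u - 7/10)\<^sup>2"
    using assms by simp
  then have "14/10 * u\<^sup>2 - 49/100 * u \<le> u ^ 3"
    by (simp add: power2_eq_square power3_eq_cube algebra_simps)
  moreover have "12/10 * u - 36/100 \<le> u\<^sup>2"
    using zero_le_power2[of "u - 6/10"] by (simp add: power2_eq_square algebra_simps)
  ultimately show ?thesis
    using assms by argo
qed

text \<open>The drift terms, which couple a step with all earlier ones, are estimated only after
  summation over \<open>t\<close>. There \<open>b * real T\<close> bounds them by 36/1000 times a
  sum of squares or cubes, which the margins absorb.\<close>

lemma total_decrease:
  fixes u :: "nat \<Rightarrow> real"
  assumes u: "\<And>t. 0 \<le> u t" and b: "0 \<le> b" "b * real T \<le> 72/1000"
    and gradient: "\<And>t. t < T \<Longrightarrow>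
      994/1000 \<le> 787/1000 * (u t)\<^sup>2 + 45/1000 * u t + b * ((\<Sum>i<t. u i) * u t)"
  shows "real T / 384 \<le> (\<Sum>t<T. 154/1000 * u t ^ 3 - 6/1000 * u t - 225/10000 * (u t)\<^sup>2
           - b / 2 * ((\<Sum>i<t. u i) * (u t)\<^sup>2))"
proof -
  let ?U = "\<lambda>t. \<Sum>i<t. u i"
  have "(\<Sum>t<T. ?U t * u t) + 1/2 * (\<Sum>t<T. (u t)\<^sup>2) \<le> 1/2 * (real T * (\<Sum>t<T. (u t)\<^sup>2))"
  proof (rule sum_prefix_product_le)
    show "u i * u t \<le> 1/2 * ((u i)\<^sup>2 + (u t)\<^sup>2)" for i t
      using sum_squares_bound[of "u i" "u t"] by simp
  qed
  then have "(\<Sum>t<T. ?U t * u t) \<le> 1/2 * (real T * (\<Sum>t<T. (u t)\<^sup>2))"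
    using sum_nonneg[of "{..<T}" "\<lambda>t. (u t)\<^sup>2"] by simp
  then have "b * (\<Sum>t<T. ?U t * u t) \<le> b * (1/2 * (real T * (\<Sum>t<T. (u t)\<^sup>2)))"
    by (rule mult_left_mono) (rule b)
  also have "\<dots> \<le> 36/1000 * (\<Sum>t<T. (u t)\<^sup>2)"
    using mult_right_mono[OF b(2), of "\<Sum>t<T. (u t)\<^sup>2"] by (simp add: sum_nonneg mult.assoc)
  finally have 1: "b * (\<Sum>t<T. ?U t * u t) \<le> 36/1000 * (\<Sum>t<T. (u t)\<^sup>2)" .
  have "(\<Sum>t<T. ?U t * (u t)\<^sup>2) + 1 * (\<Sum>t<T. u t ^ 3) \<le> 1 * (real T * (\<Sum>t<T. u t ^ 3))"
  proof (rule sum_prefix_product_le)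
    fix i t
    \<comment> \<open>The product is at most the cube of the larger factor.\<close>
    show "u i * (u t)\<^sup>2 \<le> 1 * (u i ^ 3 + u t ^ 3)"
    proof (cases "u i \<le> u t")
      case True
      then have "u i * (u t)\<^sup>2 \<le> u t * (u t)\<^sup>2"
        by (rule mult_right_mono) simp
      then show ?thesis
        using zero_le_power[OF u, of i 3] by (simp add: power3_eq_cube power2_eq_square)
    next
      case False
      then have "u i * (u t)\<^sup>2 \<le> u i * (u i)\<^sup>2"
        by (intro mult_left_mono power_mono u) simp
      then show ?thesis
        using zero_le_power[OF u, of t 3] by (simp add: power3_eq_cube power2_eq_square)
    qed
  qed
  then have "(\<Sum>t<T. ?U t * (u t)\<^sup>2) \<le> real T * (\<Sum>t<T. u t ^ 3)"
    using sum_nonneg[of "{..<T}" "\<lambda>t. u t ^ 3"] u by simp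
  then have "b / 2 * (\<Sum>t<T. ?U t * (u t)\<^sup>2) \<le> b / 2 * (real T * (\<Sum>t<T. u t ^ 3))"
    by (rule mult_left_mono) (use b in simp)
  also have "\<dots> \<le> 36/1000 * (\<Sum>t<T. u t ^ 3)"
    using mult_right_mono[OF b(2), of "\<Sum>t<T. u t ^ 3"] u by (simp add: sum_nonneg mult.assoc)
  finally have 2: "b / 2 * (\<Sum>t<T. ?U t * (u t)\<^sup>2) \<le> 36/1000 * (\<Sum>t<T. u t ^ 3)" .
  have "(\<Sum>t<T. 994/1000) \<le> (\<Sum>t<T. 787/1000 * (u t)\<^sup>2 + 45/1000 * u t + b * (?U t * u t))"
    by (intro sum_mono gradient) simp
  then have 3: "real T * (994/1000) \<le> 787/1000 * (\<Sum>t<T. (u t)\<^sup>2) + 45/1000 * (\<Sum>t<T. u t)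
      + b * (\<Sum>t<T. ?U t * u t)"
    by (simp only: sum.distrib sum_distrib_left[symmetric] sum_constant card_lessThan)
  \<comment> \<open>Here 118/1000 is 154/1000 minus the 36/1000 lost in the second drift estimate,
    and 83/100 exceeds 787/1000 plus the 36/1000 from the first.\<close>
  have "(\<Sum>t<T. 1/384 + 1/10 * (83/100 * (u t)\<^sup>2 + 45/1000 * u t - 994/1000))
      \<le> (\<Sum>t<T. 118/1000 * u t ^ 3 - 6/1000 * u t - 225/10000 * (u t)\<^sup>2)"
    by (intro sum_mono cubic_decrease_margin u)
  then have "real T * (1/384) + 1/10 * (83/100 * (\<Sum>t<T. (u t)\<^sup>2) + 45/1000 * (\<Sum>t<T. u t) - real T * (994/1000))
      \<le> 118/1000 * (\<Sum>t<T. u t ^ 3) - 6/1000 * (\<Sum>t<T. u t) - 225/10000 * (\<Sum>t<T. (u t)\<^sup>2)"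
    by (simp only: sum.distrib sum_subtractf sum_distrib_left[symmetric] sum_constant card_lessThan)
  moreover have "0 \<le> (\<Sum>t<T. (u t)\<^sup>2)"
    by (simp add: sum_nonneg)
  ultimately have "real T / 384 \<le> 154/1000 * (\<Sum>t<T. u t ^ 3) - 6/1000 * (\<Sum>t<T. u t)
      - 225/10000 * (\<Sum>t<T. (u t)\<^sup>2) - b / 2 * (\<Sum>t<T. ?U t * (u t)\<^sup>2)"
    using 1 2 3 by argo
  then show ?thesis
    by (simp only: sum_subtractf sum_distrib_left[symmetric])
qed

text \<open>This is the local convergence argument in scalars: \<open>G\<close> stands for composite
  gradient norms, \<open>r\<close> for step lengths, and the sum of the earlier \<open>r i\<close>
  bounds the distance to the point where the Hessian was frozen. In the application \<open>M\<close>
  is the number of inner steps and \<open>X\<close> is \<open>max \<tau>0 L\<close>.\<close>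

lemma superlinear_recursion:
  fixes G r :: "nat \<Rightarrow> real"
  assumes pos: "0 < \<mu>" "0 < X" "0 < \<kappa>" "0 < \<epsilon>" "0 \<le> L" "0 < \<sigma>" "0 \<le> eB" "1 \<le> M"
    and r: "\<And>t. 0 \<le> r t"
    and G: "\<And>t. t \<le> m \<Longrightarrow> \<epsilon> \<le> G t" and start: "G 0 \<le> \<kappa> / 2"
    and gradient: "\<And>t. t < m \<Longrightarrow>
      G (Suc t) \<le> (3/4 * \<sigma> + L / 2) * (r t)\<^sup>2 + eg + (L * (\<Sum>i<t. r i) + eB) * r t"
    and length: "\<And>t. t < m \<Longrightarrow> (\<mu> - eB) * (r t)\<^sup>2 + \<sigma> / 4 * r t ^ 3 \<le> (G t + eg) * r t"
    and eg: "eg \<le> \<epsilon> / 4" and eB: "eB\<^sup>2 \<le> 13/10 * (L * M * \<epsilon>)"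
    and \<sigma>: "\<sigma> \<le> 2816/100 * (M * X)" and LX: "L \<le> X" and \<kappa>: "334 * (M * X * \<kappa>) \<le> \<mu>\<^sup>2"
    and "t \<le> m"
  shows "G t \<le> \<kappa> * (G 0 / \<kappa>) ^ Suc t"
proof -
  have G0: "0 < G 0"
    using G[of 0] pos by simp
  have LM: "L * M \<le> M * X" "L \<le> M * X" "0 \<le> L * M"
  proof -
    show "L * M \<le> M * X"
      using LX pos by (simp add: mult.commute mult_left_mono)
    moreover have "L * 1 \<le> L * M"
      using pos by (intro mult_left_mono) auto
    ultimately show "L \<le> M * X"
      by linarith
    show "0 \<le> L * M"
      using pos by simp
  qed
  \<comment> \<open>At least 5/6 of the curvature survives the Hessian error. Together with
    \<open>eg \<le> G t / 4\<close> this gives the ratio 3/2 = (5/4) / (5/6) in the bound on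
    \<open>r t\<close>.\<close>
  have "eB \<le> \<mu> / 6"
  proof (rule power2_le_imp_le)
    have "\<epsilon> \<le> \<kappa> / 2"
      using G[of 0] start by simp
    then have "L * M * \<epsilon> \<le> M * X * (\<kappa> / 2)"
      by (rule mult_mono[OF LM(1)]) (use pos in auto)
    moreover have "0 \<le> \<mu>\<^sup>2"
      by simp
    ultimately have "eB\<^sup>2 \<le> \<mu>\<^sup>2 / 36"
      using eB \<kappa> by argo
    then show "eB\<^sup>2 \<le> (\<mu> / 6)\<^sup>2"
      by (simp add: power_divide)
  qed (use pos in simp)
  note eB_le = this
  \<comment> \<open>The assumed path length \<open>3 * G 0 / \<mu>\<close> is the sum of the
    geometric series with first term \<open>3/2 * G 0 / \<mu>\<close> and ratio 1/2. The induction
    below supplies it.\<close>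
  have step: "r t \<le> 3/2 * G t / \<mu> \<and> G (Suc t) \<le> G 0 / \<kappa> * G t"
    if t: "t < m" and Gt: "G t \<le> G 0" and D: "(\<Sum>i<t. r i) \<le> 3 * G 0 / \<mu>" for t
  proof
    have Gpos: "\<epsilon> \<le> G t" "0 < G t" "\<epsilon> \<le> G (Suc t)"
      using G[of t] G[of "Suc t"] t pos by auto
    show rt: "r t \<le> 3/2 * G t / \<mu>"
    proof (cases "r t = 0")
      case True
      then show ?thesis using Gpos pos by simp
    next
      case False
      then have rpos: "0 < r t"
        using r[of t] by simp
      have "5/6 * \<mu> * (r t)\<^sup>2 \<le> (\<mu> - eB) * (r t)\<^sup>2"
        using eB_le by (intro mult_right_mono) auto
      also have "\<dots> \<le> (G t + eg) * r t"
        using length[OF t] pos rpos by (smt (verit) mult_nonneg_nonneg zero_le_power divide_nonneg_pos)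
      finally have "5/6 * \<mu> * r t * r t \<le> (G t + eg) * r t"
        by (simp add: power2_eq_square mult.assoc)
      then have "5/6 * \<mu> * r t \<le> G t + eg"
        using rpos by (simp add: mult_le_cancel_right)
      also have "\<dots> \<le> 5/4 * G t"
        using eg Gpos by simp
      finally show ?thesis
        using pos by (simp add: field_simps)
    qed
    \<comment> \<open>Common unit for all second order terms; a square of \<open>G t\<close> is
      weakened to \<open>G 0 * G t\<close>.\<close>
    define P where "P = G 0 * G t / \<mu>\<^sup>2"
    have P: "0 \<le> P"
      using G0 Gpos by (simp add: P_def)
    have "(r t)\<^sup>2 \<le> (3/2 * G t / \<mu>)\<^sup>2"
      using rt r by (intro power_mono) auto
    also have "\<dots> \<le> 9/4 * P"
      using Gt Gpos pos by (simp add: P_def power2_eq_square field_simps mult_right_mono)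
    finally have r2: "(r t)\<^sup>2 \<le> 9/4 * P" .
    have "(\<Sum>i<t. r i) * r t \<le> (3 * G 0 / \<mu>) * (3/2 * G t / \<mu>)"
      using D rt r G0 pos by (intro mult_mono) auto
    also have "\<dots> = 9/2 * P"
      by (simp add: P_def power2_eq_square)
    finally have Dr: "(\<Sum>i<t. r i) * r t \<le> 9/2 * P" .
    \<comment> \<open>Young's inequality splits the first order Hessian error into a fraction of
      \<open>\<epsilon>\<close> and a second order term.\<close>
    have "eB * r t \<le> \<epsilon> / 4 + (eB * r t)\<^sup>2 / \<epsilon>"
    proof -
      have "0 \<le> (eB * r t - \<epsilon> / 2)\<^sup>2 / \<epsilon>"
        using pos by simp
      also have "\<dots> = (eB * r t)\<^sup>2 / \<epsilon> - eB * r t + \<epsilon> / 4"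
        using pos by (simp add: power2_eq_square field_simps)
      finally show ?thesis by simp
    qed
    also have "(eB * r t)\<^sup>2 / \<epsilon> \<le> 13/10 * (L * M) * (r t)\<^sup>2"
      using mult_right_mono[OF eB, of "(r t)\<^sup>2"] pos
      by (simp add: power_mult_distrib field_simps)
    finally have eBr: "eB * r t \<le> \<epsilon> / 4 + 13/10 * (L * M) * (r t)\<^sup>2"
      by simp
    \<comment> \<open>Both \<open>eg\<close> and the quarter from Young's inequality are at most a
      quarter of \<open>G (Suc t)\<close>, because the new gradient is still at least
      \<open>\<epsilon>\<close>. They are moved to the left.\<close>
    have "1/2 * G (Suc t) \<le> (3/4 * \<sigma> + L / 2 + 13/10 * (L * M)) * (r t)\<^sup>2 + L * ((\<Sum>i<t. r i) * r t)"
      using gradient[OF t] eg eBr Gpos by (simp add: algebra_simps)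
    also have "\<dots> \<le> (3/4 * \<sigma> + L / 2 + 13/10 * (L * M)) * (9/4 * P) + L * (9/2 * P)"
      using pos LM by (intro add_mono mult_left_mono r2 Dr) auto
    also have "\<dots> = (27/16 * \<sigma> + 9/8 * L + 117/40 * (L * M) + 9/2 * L) * P"
      by (simp add: algebra_simps)
    also have "\<dots> \<le> (57 * (M * X)) * P"
    proof (rule mult_right_mono[OF _ P])
      have "0 \<le> M * X"
        using pos by simp
      then show "27/16 * \<sigma> + 9/8 * L + 117/40 * (L * M) + 9/2 * L \<le> 57 * (M * X)"
        using \<sigma> LM by linarith
    qed
    also have "\<dots> \<le> 1/2 * (\<mu>\<^sup>2 / \<kappa>) * P"
    proof (rule mult_right_mono[OF _ P])
      have "0 \<le> M * X * \<kappa>"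
        using pos by simp
      then have "114 * (M * X * \<kappa>) \<le> \<mu>\<^sup>2"
        using \<kappa> by linarith
      then show "57 * (M * X) \<le> 1/2 * (\<mu>\<^sup>2 / \<kappa>)"
        using pos by (simp add: field_simps)
    qed
    also have "\<dots> = 1/2 * (G 0 / \<kappa> * G t)"
      using pos by (simp add: P_def)
    finally show "G (Suc t) \<le> G 0 / \<kappa> * G t"
      by simp
  qed
  \<comment> \<open>The first two conjuncts, from \<open>G 0 / \<kappa> \<le> 1 / 2\<close>, keep
    the premises of \<open>step\<close> alive. The third is the actual rate.\<close>
  have "t \<le> m \<Longrightarrow> G t \<le> G 0 * (1/2) ^ t \<and> (\<Sum>i<t. r i) \<le> 3 * G 0 / \<mu> * (1 - (1/2) ^ t)
      \<and> G t \<le> \<kappa> * (G 0 / \<kappa>) ^ Suc t" for t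
  proof (induction t)
    case 0
    then show ?case using pos by simp
  next
    case (Suc t)
    then have IH: "G t \<le> G 0 * (1/2) ^ t" "(\<Sum>i<t. r i) \<le> 3 * G 0 / \<mu> * (1 - (1/2) ^ t)"
      "G t \<le> \<kappa> * (G 0 / \<kappa>) ^ Suc t" and t: "t < m"
      by auto
    have "G 0 * (1/2) ^ t \<le> G 0 * 1"
      using G0 by (intro mult_left_mono) (auto simp: power_le_one)
    moreover have "3 * G 0 / \<mu> * (1 - (1/2) ^ t) \<le> 3 * G 0 / \<mu> * 1"
      using G0 pos by (intro mult_left_mono) auto
    ultimately have st: "r t \<le> 3/2 * G t / \<mu>" "G (Suc t) \<le> G 0 / \<kappa> * G t"
      using step[OF t] IH by auto
    have "G (Suc t) \<le> 1/2 * (G 0 * (1/2) ^ t)"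
    proof -
      have "G 0 / \<kappa> * G t \<le> 1/2 * (G 0 * (1/2) ^ t)"
        using IH(1) start pos G0 G[of t] t by (intro mult_mono) (auto simp: field_simps)
      with st(2) show ?thesis by (rule order_trans)
    qed
    moreover have "(\<Sum>i<Suc t. r i) \<le> 3 * G 0 / \<mu> * (1 - (1/2) ^ Suc t)"
    proof -
      have "r t \<le> 3/2 * (G 0 * (1/2) ^ t) / \<mu>"
        by (rule order_trans[OF st(1)], intro divide_right_mono mult_left_mono IH(1))
          (use pos in auto)
      then have "(\<Sum>i<Suc t. r i) \<le> 3 * G 0 / \<mu> * (1 - (1/2) ^ t) + 3/2 * (G 0 * (1/2) ^ t) / \<mu>"
        using IH(2) by simp
      also have "\<dots> = 3 * G 0 / \<mu> * (1 - (1/2) ^ Suc t)"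
      proof -
        have "3 * G 0 / \<mu> * (1 - e) + 3/2 * (G 0 * e) / \<mu> = 3 * G 0 / \<mu> * (1 - 1/2 * e)" for e
          using pos by (simp add: field_simps)
        then show ?thesis
          by (simp only: power_Suc)
      qed
      finally show ?thesis .
    qed
    moreover have "G (Suc t) \<le> \<kappa> * (G 0 / \<kappa>) ^ Suc (Suc t)"
    proof -
      have "G 0 / \<kappa> * G t \<le> G 0 / \<kappa> * (\<kappa> * (G 0 / \<kappa>) ^ Suc t)"
        using IH(3) G0 pos by (intro mult_left_mono) auto
      also have "\<dots> = \<kappa> * (G 0 / \<kappa>) ^ Suc (Suc t)"
        by simp
      finally show ?thesis
        using st(2) by (rule order_trans[rotated])
    qed
    ultimately show ?case by simp
  qed
  then show ?thesis
    using \<open>t \<le> m\<close> by blast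
qed

section \<open>Calls of the inner procedure\<close>

context lipschitz_hessian
begin

context
  fixes \<psi> :: "real^'n \<Rightarrow> ereal" and x :: "real^'n" and \<theta> \<epsilon> :: real and m :: nat
    and c :: "(real^'n) call"
  assumes psi: "\<And>y. \<psi> y \<noteq> -\<infinity>" and x: "x \<in> edom \<psi>"
    and pos: "0 < \<theta>" "0 < \<epsilon>" "1 \<le> m"
    and call: "zero_order_cubic_steps f \<psi> x (fd_hessian f (cnm_stepsize CARD('n) m \<epsilon> \<theta>) x)
      (cnm_sigma m \<theta>) m \<epsilon> c"
begin

abbreviation (input) "\<sigma> \<equiv> cnm_sigma m \<theta>"
abbreviation (input) "B \<equiv> fd_hessian f (cnm_stepsize CARD('n) m \<epsilon> \<theta>) x"
abbreviation (input) "eg \<equiv> L / 6 * (grad_const\<^sup>2 * \<epsilon> / \<theta>)"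
text \<open>The factor 9/200 is 3/2 from \<open>fd_hessian_error\<close> times 3/100 from
  \<open>cnm_stepsize_le\<close>.\<close>

abbreviation (input) "eB \<equiv> 9/200 * (L * (sqrt (\<sigma> * \<epsilon>) / \<theta>))"
abbreviation (input) "r t \<equiv> norm (iter c (Suc t) - iter c t)"
abbreviation (input) "F t \<equiv> f (iter c t) + real_of_ereal (\<psi> (iter c t))"

lemma sigma_pos: "0 < \<sigma>"
  using pos by (simp add: cnm_sigma_def)

lemma call_step:
  "t < steps c \<Longrightarrow> cubic_step f \<psi> B \<sigma> m \<epsilon> (iter c t) (iter c (Suc t)) (subgr c (Suc t))"
  using call unfolding zero_order_cubic_steps_def by blast

lemma call_iter_0: "iter c 0 = x" and call_steps: "1 \<le> steps c" "steps c \<le> m"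
  using call unfolding zero_order_cubic_steps_def by blast+

lemma call_edom: "t \<le> steps c \<Longrightarrow> iter c t \<in> edom \<psi>"
  using call_step[of "t - 1"] x call_iter_0
  by (cases t) (auto simp: cubic_step_def Let_def)

lemma call_subdiff: "1 \<le> t \<Longrightarrow> t \<le> steps c \<Longrightarrow> subgr c t \<in> subdiff \<psi> (iter c t)"
  using call_step[of "t - 1"] by (cases t) (auto simp: cubic_step_def Let_def)

lemma call_dist: "norm (iter c t - x) \<le> (\<Sum>i<t. r i)"
proof (induction t)
  case (Suc t)
  have "norm (iter c (Suc t) - x) \<le> norm (iter c t - x) + r t"
    using norm_triangle_ineq[of "iter c t - x" "iter c (Suc t) - iter c t"] by simp
  with Suc show ?case by simp
qed (simp add: call_iter_0)

lemma call_gradient_error: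
  "norm (fd_gradient f (grad_stepsize CARD('n) \<sigma> m \<epsilon>) y - gradient f y) \<le> eg"
proof -
  let ?h = "grad_stepsize CARD('n) \<sigma> m \<epsilon>"
  have "norm (fd_gradient f ?h y - gradient f y) \<le> sqrt (real CARD('n)) * (L / 6 * ?h\<^sup>2)"
    using grad_stepsize_pos sigma_pos pos by (intro fd_gradient_error) simp
  also have "\<dots> = L / 6 * (sqrt (real CARD('n)) * ?h\<^sup>2)"
    by simp
  also have "\<dots> = eg"
    using grad_stepsize_square pos by simp
  finally show ?thesis .
qed

lemma call_hessian_error: "norm ((B - hessian f x) *v v) \<le> eB * norm v"
proof -
  let ?h = "cnm_stepsize CARD('n) m \<epsilon> \<theta>"
  have "norm ((B - hessian f x) *v v) \<le> real CARD('n) * (3 / 2 * L * ?h) * norm v"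
    using cnm_stepsize_pos pos by (intro fd_hessian_error) simp
  also have "\<dots> = 3 / 2 * L * (real CARD('n) * ?h) * norm v"
    by simp
  also have "\<dots> \<le> 3 / 2 * L * (3/100 * (sqrt (\<sigma> * \<epsilon>) / \<theta>)) * norm v"
    using cnm_stepsize_le pos L_nonneg by (intro mult_right_mono mult_left_mono) auto
  finally show ?thesis
    by simp
qed

text \<open>These instantiate the premises of the single-step bounds, with the start
  \<open>x\<close> of the call as \<open>z\<close> and the path length so far as
  \<open>D\<close>.\<close>

lemmas call_step_facts = call_step transpose_fd_hessian call_gradient_error call_hessian_error call_dist

lemma call_gradient_bound:
  assumes "t < steps c"
  shows "norm (gradient f (iter c (Suc t)) + subgr c (Suc t))
    \<le> (3/4 * \<sigma> + L / 2) * (r t)\<^sup>2 + eg + (L * (\<Sum>i<t. r i) + eB) * r t"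
  by (rule cubic_step_gradient_bound[OF call_step_facts sigma_pos]) (fact assms)

lemma call_decrease_bound:
  assumes "t < steps c"
  shows "F (Suc t) \<le> F t + eg * r t + 1/2 * (L * (\<Sum>i<t. r i) + eB) * (r t)\<^sup>2 - (\<sigma> - L) / 6 * r t ^ 3"
  by (rule cubic_step_decrease[OF call_step_facts psi]) (use assms call_edom in auto)

lemma call_length_bound:
  assumes "t < steps c" "s0 \<in> subdiff \<psi> (iter c t)" "psd (hessian f x - \<mu> *\<^sub>R mat 1)"
  shows "(\<mu> - eB) * (r t)\<^sup>2 + \<sigma> / 4 * r t ^ 3 \<le> (norm (gradient f (iter c t) + s0) + eg) * r t"
  by (rule cubic_step_length_bound[OF call_step_facts psi]) (use assms in auto)

lemma decrease_test_iff:
  assumes "t \<le> steps c"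
  shows "decrease_test f \<psi> \<sigma> \<epsilon> (iter c 0) t (iter c t)
    \<longleftrightarrow> \<epsilon> powr (3/2) / (384 * \<sigma> powr (1/2)) * real t \<le> F 0 - F t"
proof -
  obtain a b where ab: "\<psi> (iter c 0) = ereal a" "\<psi> (iter c t) = ereal b"
    using edom_real[OF psi call_edom] assms by blast
  show ?thesis
    unfolding decrease_test_def objective_def ab by simp
qed

text \<open>Rescaling lengths by \<open>q = sqrt (\<epsilon> / \<sigma>)\<close> makes the gradient and the decrease bounds
  dimensionless.\<close>

lemma call_succeeds:
  assumes "L \<le> \<theta>"
    and gradients: "\<And>t. 1 \<le> t \<Longrightarrow> t \<le> steps c \<Longrightarrow> \<epsilon> < norm (gradient f (iter c t) + subgr c t)"
  shows "flag c = Success"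
proof -
  define T where "T = steps c"
  define q where "q = sqrt (\<epsilon> / \<sigma>)"
  define u where "u t = r t / q" for t
  define b where "b = L / \<sigma>"
  have q: "0 < q" "\<epsilon> = \<sigma> * q\<^sup>2" "sqrt (\<sigma> * \<epsilon>) = \<sigma> * q"
    using pos sigma_pos by (simp_all add: q_def real_sqrt_divide real_sqrt_mult field_simps)
  have r_eq: "r t = q * u t" and sum_r: "(\<Sum>i<t. r i) = q * (\<Sum>i<t. u i)" for t
    using q by (simp_all add: u_def sum_distrib_left)
  have L_eq: "L = b * \<sigma>"
    using sigma_pos by (simp add: b_def)
  have m1: "1 \<le> real m"
    using pos by simp
  \<comment> \<open>The regularization grows with \<open>m\<close>, so the drift over a whole call
    stays small relative to it: \<open>b * real m\<close> is at most 1 / 13.92.\<close>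
  have Lm: "1392/100 * (L * real m) \<le> \<sigma>"
    using cnm_sigma_bounds(1)[of \<theta> m] mult_right_mono[OF assms(1) of_nat_0_le_iff[of m]] pos
    by linarith
  have b0: "0 \<le> b"
    using L_nonneg sigma_pos by (simp add: b_def)
  have bm: "b * real m \<le> 72/1000"
    using Lm sigma_pos by (simp add: b_def field_simps)
  have bT: "b * real T \<le> 72/1000"
    using mult_left_mono[of "real T" "real m" b] call_steps b0 bm by (simp add: T_def)
  have b1: "b \<le> 72/1000"
    using mult_left_mono[OF m1 b0] bm by simp
  have Lth: "L / \<theta> \<le> 1" "0 \<le> L / \<theta>"
    using assms(1) pos L_nonneg by simp_all
  have eg: "eg \<le> 6/1000 * (\<sigma> * q\<^sup>2)"
  proof -
    have "eg = L / \<theta> * grad_const\<^sup>2 * \<epsilon> / 6"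
      by simp
    also have "\<dots> \<le> 1 * (1/28) * \<epsilon> / 6"
      using Lth grad_const_square_bounds pos
      by (intro divide_right_mono mult_right_mono mult_mono) auto
    also have "\<dots> \<le> 6/1000 * \<epsilon>"
      using pos by simp
    also have "6/1000 * \<epsilon> = 6/1000 * (\<sigma> * q\<^sup>2)"
      using q(2) by simp
    finally show ?thesis .
  qed
  have eB: "eB \<le> 45/1000 * (\<sigma> * q)"
  proof -
    have "eB = 45/1000 * (L / \<theta> * (\<sigma> * q))"
      unfolding q(3) by simp
    also have "\<dots> \<le> 45/1000 * (1 * (\<sigma> * q))"
      by (intro mult_left_mono mult_right_mono Lth) (use q sigma_pos in auto)
    finally show ?thesis
      by simp
  qed
  have "real T / 384 \<le> (\<Sum>t<T. 154/1000 * u t ^ 3 - 6/1000 * u t - 225/10000 * (u t)\<^sup>2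
      - b / 2 * ((\<Sum>i<t. u i) * (u t)\<^sup>2))"
  proof (rule total_decrease[OF _ b0 bT])
    show "0 \<le> u t" for t
      using q by (simp add: u_def)
    fix t
    assume t: "t < T"
    have "\<epsilon> \<le> (3/4 * \<sigma> + L / 2) * (r t)\<^sup>2 + eg + (L * (\<Sum>i<t. r i) + eB) * r t"
      using gradients[of "Suc t"] call_gradient_bound[of t] t unfolding T_def by linarith
    also have "\<dots> \<le> (3/4 * \<sigma> + L / 2) * (r t)\<^sup>2 + 6/1000 * (\<sigma> * q\<^sup>2)
        + (L * (\<Sum>i<t. r i) + 45/1000 * (\<sigma> * q)) * r t"
      by (intro add_mono mult_right_mono order_refl eg eB) simp
    also have "\<dots> = \<sigma> * q\<^sup>2 * ((3/4 + b / 2) * (u t)\<^sup>2 + 6/1000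
        + (b * ((\<Sum>i<t. u i) * u t) + 45/1000 * u t))"
      unfolding sum_r unfolding r_eq L_eq by (simp add: power2_eq_square algebra_simps)
    finally have "\<sigma> * q\<^sup>2 * 1 \<le> \<sigma> * q\<^sup>2 * ((3/4 + b / 2) * (u t)\<^sup>2 + 6/1000
        + (b * ((\<Sum>i<t. u i) * u t) + 45/1000 * u t))"
      using q(2) by simp
    then have "1 \<le> (3/4 + b / 2) * (u t)\<^sup>2 + 6/1000 + (b * ((\<Sum>i<t. u i) * u t) + 45/1000 * u t)"
      using q(1) sigma_pos by (subst (asm) mult_le_cancel_left_pos) auto
    moreover have "(3/4 + b / 2) * (u t)\<^sup>2 \<le> 787/1000 * (u t)\<^sup>2"
      using b1 by (intro mult_right_mono) auto
    ultimately show "994/1000 \<le> 787/1000 * (u t)\<^sup>2 + 45/1000 * u t + b * ((\<Sum>i<t. u i) * u t)"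
      by argo
  qed
  then have "\<sigma> * q ^ 3 * (real T / 384) \<le> \<sigma> * q ^ 3 * (\<Sum>t<T. 154/1000 * u t ^ 3 - 6/1000 * u t
      - 225/10000 * (u t)\<^sup>2 - b / 2 * ((\<Sum>i<t. u i) * (u t)\<^sup>2))"
    by (rule mult_left_mono) (use q sigma_pos in simp)
  also have "\<dots> \<le> (\<Sum>t<T. F t - F (Suc t))"
    unfolding sum_distrib_left
  proof (rule sum_mono)
    fix t
    assume "t \<in> {..<T}"
    then have t: "t < T"
      by simp
    have u0: "0 \<le> u t"
      using q by (simp add: u_def)
    \<comment> \<open>Since \<open>b\<close> is at most 72/1000, the quotient
      \<open>(1 - b) / 6\<close> exceeds 154/1000.\<close>
    have "154/1000 * u t ^ 3 \<le> (1 - b) / 6 * u t ^ 3"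
      using b1 u0 by (intro mult_right_mono) auto
    then have "\<sigma> * q ^ 3 * (154/1000 * u t ^ 3 - 6/1000 * u t
        - 225/10000 * (u t)\<^sup>2 - b / 2 * ((\<Sum>i<t. u i) * (u t)\<^sup>2))
      \<le> \<sigma> * q ^ 3 * ((1 - b) / 6 * u t ^ 3 - 6/1000 * u t
        - 225/10000 * (u t)\<^sup>2 - b / 2 * ((\<Sum>i<t. u i) * (u t)\<^sup>2))"
      by (intro mult_left_mono diff_right_mono) (use q sigma_pos in simp_all)
    also have "\<dots> = (\<sigma> - L) / 6 * r t ^ 3 - (6/1000 * (\<sigma> * q\<^sup>2)) * r t
        - 1/2 * (L * (\<Sum>i<t. r i) + 45/1000 * (\<sigma> * q)) * (r t)\<^sup>2"
      unfolding sum_r unfolding r_eq L_eq by (simp add: power2_eq_square power3_eq_cube field_simps)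
    also have "\<dots> \<le> (\<sigma> - L) / 6 * r t ^ 3 - eg * r t
        - 1/2 * (L * (\<Sum>i<t. r i) + eB) * (r t)\<^sup>2"
      by (intro diff_mono order_refl mult_right_mono mult_left_mono add_left_mono eg eB) simp_all
    also have "\<dots> \<le> F t - F (Suc t)"
      using call_decrease_bound[of t] t unfolding T_def by linarith
    finally show "\<sigma> * q ^ 3 * (154/1000 * u t ^ 3 - 6/1000 * u t
        - 225/10000 * (u t)\<^sup>2 - b / 2 * ((\<Sum>i<t. u i) * (u t)\<^sup>2)) \<le> F t - F (Suc t)" .
  qed
  also have "\<dots> = F 0 - F T"
    by (rule sum_lessThan_telescope')
  finally have "\<sigma> * q ^ 3 * (real T / 384) \<le> F 0 - F T" .
  \<comment> \<open>The threshold of the test, in the scaled units, is exactly 1/384 per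
    step.\<close>
  moreover have "\<epsilon> powr (3/2) / (384 * \<sigma> powr (1/2)) * real T = \<sigma> * q ^ 3 * (real T / 384)"
  proof -
    have "\<epsilon> powr (3/2) = sqrt \<epsilon> ^ 3"
      using pos by (simp add: powr_half_sqrt[symmetric] powr_powr flip: powr_realpow)
    also have "sqrt \<epsilon> = sqrt \<sigma> * q"
      using sigma_pos by (simp add: q_def real_sqrt_divide)
    finally show ?thesis
      using sigma_pos by (simp add: powr_half_sqrt power3_eq_cube)
  qed
  ultimately have "decrease_test f \<psi> \<sigma> \<epsilon> (iter c 0) (steps c) (iter c (steps c))"
    unfolding T_def by (subst decrease_test_iff) auto
  then show ?thesis
    using call unfolding zero_order_cubic_steps_def by (cases "flag c") auto
qed

text \<open>The subgradient \<open>s0\<close> at the start is arbitrary, so that a later call can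
  use the one that certified its starting point in the call before.\<close>

lemma call_superlinear:
  assumes success: "flag c = Success"
    and gradients: "\<And>t. 1 \<le> t \<Longrightarrow> t \<le> steps c \<Longrightarrow> \<epsilon> < norm (gradient f (iter c t) + subgr c t)"
    and s0: "s0 \<in> subdiff \<psi> x" and start: "\<epsilon> \<le> norm (gradient f x + s0)"
      "norm (gradient f x + s0) \<le> \<kappa> / 2"
    and mu: "0 < \<mu>" "psd (hessian f x - \<mu> *\<^sub>R mat 1)"
    and \<theta>: "L * grad_const\<^sup>2 \<le> 3/2 * \<theta>" "\<theta> \<le> 2 * X" and X: "L \<le> X"
    and \<kappa>: "334 * (real m * X * \<kappa>) \<le> \<mu>\<^sup>2"
  shows "steps c = m"
    and "norm (gradient f (iter c m) + subgr c m) \<le> \<kappa> * (norm (gradient f x + s0) / \<kappa>) ^ Suc m"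
proof -
  show m: "steps c = m"
    using call success unfolding zero_order_cubic_steps_def by simp
  define s where "s t = (if t = 0 then s0 else subgr c t)" for t
  define G where "G t = norm (gradient f (iter c t) + s t)" for t
  have G0: "G 0 = norm (gradient f x + s0)"
    by (simp add: G_def s_def call_iter_0)
  \<comment> \<open>The lower bound on the trial value also controls the Hessian error; 45 is 3/2
    times 30, from \<open>1/30 \<le> grad_const\<^sup>2\<close>.\<close>
  have L\<theta>: "L \<le> 45 * \<theta>"
    using mult_left_mono[OF grad_const_square_bounds(1) L_nonneg] \<theta>(1) by simp
  have "G m \<le> \<kappa> * (G 0 / \<kappa>) ^ Suc m"
  proof (rule superlinear_recursion[where r = "\<lambda>t. r t" and \<epsilon> = \<epsilon> and L = L and \<sigma> = \<sigma> and eB = eB and eg = eg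
        and M = "real m" and X = X and \<mu> = \<mu> and m = m])
    show "0 < \<mu>" "0 < \<epsilon>" "0 \<le> L" "0 < \<sigma>" "L \<le> X" "334 * (real m * X * \<kappa>) \<le> \<mu>\<^sup>2"
      using mu pos L_nonneg sigma_pos X \<kappa> by auto
    show "0 < X"
      using pos \<theta> by simp
    show "0 < \<kappa>"
      using start pos by simp
    show "0 \<le> eB"
      using L_nonneg pos sigma_pos by simp
    show "1 \<le> real m"
      using pos by simp
    show "0 \<le> r t" for t
      by simp
    show "\<epsilon> \<le> G t" if "t \<le> m" for t
      using that start gradients[of t] m G0 by (cases "t = 0") (auto simp: G_def s_def less_imp_le)
    show "G 0 \<le> \<kappa> / 2"
      using start G0 by simp
    show "G (Suc t) \<le> (3/4 * \<sigma> + L / 2) * (r t)\<^sup>2 + eg + (L * (\<Sum>i<t. r i) + eB) * r t"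
      if "t < m" for t
      using call_gradient_bound[of t] that m by (simp add: G_def s_def)
    show "(\<mu> - eB) * (r t)\<^sup>2 + \<sigma> / 4 * r t ^ 3 \<le> (G t + eg) * r t" if "t < m" for t
    proof -
      have "s t \<in> subdiff \<psi> (iter c t)"
        using call_subdiff[of t] that m s0 by (auto simp: s_def call_iter_0)
      then show ?thesis
        unfolding G_def using that m mu by (intro call_length_bound) auto
    qed
    \<comment> \<open>This is where the initial regularization must be large: the bound on
      \<open>L * grad_const\<^sup>2\<close> gives exactly one quarter.\<close>
    show "eg \<le> \<epsilon> / 4"
      using mult_right_mono[OF \<theta>(1), of "\<epsilon> / (6 * \<theta>)"] pos by simp
    show "eB\<^sup>2 \<le> 13/10 * (L * real m * \<epsilon>)"
    proof -
      have "eB\<^sup>2 = 81/40000 * (L * (L / \<theta>) * (\<sigma> / \<theta>) * \<epsilon>)"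
        using pos sigma_pos by (simp add: power_mult_distrib power_divide power2_eq_square)
      also have "\<dots> \<le> 81/40000 * (L * 45 * (1408/100 * real m) * \<epsilon>)"
      proof (intro mult_left_mono mult_right_mono mult_mono)
        show "L / \<theta> \<le> 45"
          using L\<theta> pos by (simp add: field_simps)
        show "\<sigma> / \<theta> \<le> 1408/100 * real m"
          using cnm_sigma_bounds(2)[of \<theta> m] pos by (simp add: field_simps)
      qed (use pos sigma_pos L_nonneg in auto)
      also have "\<dots> \<le> 13/10 * (L * real m * \<epsilon>)"
        using L_nonneg pos by simp
      finally show ?thesis .
    qed
    show "\<sigma> \<le> 2816/100 * (real m * X)"
    proof -
      have "\<theta> * real m \<le> 2 * (real m * X)"
        using mult_right_mono[OF \<theta>(2) of_nat_0_le_iff[of m]] by (simp add: mult_ac)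
      then show ?thesis
        using cnm_sigma_bounds(2)[of \<theta> m] pos by linarith
    qed
  qed simp
  moreover have "G m = norm (gradient f (iter c m) + subgr c m)"
    using pos by (simp add: G_def s_def)
  ultimately show "norm (gradient f (iter c m) + subgr c m)
      \<le> \<kappa> * (norm (gradient f x + s0) / \<kappa>) ^ Suc m"
    by (simp only: G0)
qed

end

end

section \<open>Convergence\<close>

text \<open>Only the first summand of the bracket is kept, the others being nonnegative. There 192
  times 87/100 exceeds 167, and the leading factor 1/2 doubles this to 334.\<close>

lemma rate_const_bounds:
  assumes "0 < \<mu>" "0 \<le> L" "0 < \<tau>0" "1 \<le> m"
  shows "0 < rate_const \<mu> L \<tau>0 m"
    and "334 * (real m * max \<tau>0 L * rate_const \<mu> L \<tau>0 m) \<le> \<mu>\<^sup>2"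
proof -
  define w :: real where "w = (2/3) powr (1/3)"
  define c :: real where "c = 1 / (3 powr (1/6) * 2 powr (13/6))"
  define P where "P = real m * max \<tau>0 L"
  define S where "S = 8 * L + c\<^sup>2 * L\<^sup>2 * real m / \<tau>0"
  define R where "R = 192 * (w * P) + S"
  have \<kappa>: "rate_const \<mu> L \<tau>0 m = \<mu>\<^sup>2 / (2 * R)"
  proof -
    have "3 * 2 ^ 6 * w * real m * max \<tau>0 L = 192 * (w * P)"
      unfolding P_def by (simp only: mult.assoc) simp
    then have "rate_const \<mu> L \<tau>0 m = \<mu>\<^sup>2 / 2 * inverse R"
      unfolding rate_const_def Let_def w_def c_def R_def S_def by (simp only: add.assoc)
    then show ?thesis
      by (simp add: inverse_eq_divide)
  qed
  have P: "0 < P"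
    using assms by (simp add: P_def)
  have "0 \<le> S"
    using assms by (simp add: S_def)
  moreover have "87/100 * P \<le> w * P"
    unfolding w_def using P by (intro mult_right_mono two_thirds_root_bounds) simp
  ultimately have R: "167 * P \<le> R"
    using P unfolding R_def by linarith
  then show "0 < rate_const \<mu> L \<tau>0 m"
    using assms P by (simp add: \<kappa>)
  have "334 * (P * (\<mu>\<^sup>2 / (2 * R))) = \<mu>\<^sup>2 * (167 * P / R)"
    by simp
  also have "\<dots> \<le> \<mu>\<^sup>2 * 1"
    using R P by (intro mult_left_mono) auto
  finally show "334 * (real m * max \<tau>0 L * rate_const \<mu> L \<tau>0 m) \<le> \<mu>\<^sup>2"
    by (simp add: \<kappa> P_def)
qed

text \<open>Two logarithms undo the doubly exponential decay, and \<open>1 \<le> m\<close> makes the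
  divisor positive.\<close>

lemma double_log_bound:
  fixes \<epsilon> \<kappa> :: real
  assumes "0 < \<epsilon>" "1 \<le> m" "\<epsilon> \<le> \<kappa> * (1/2) ^ (Suc m ^ N)"
  shows "real N \<le> 1 / log 2 (1 + real m) * log 2 (log 2 (\<kappa> / \<epsilon>))"
proof -
  let ?K = "Suc m ^ N"
  have "2 ^ ?K \<le> \<kappa> / \<epsilon>"
    using assms by (simp add: field_simps power_one_over)
  then have "log 2 (2 ^ ?K) \<le> log 2 (\<kappa> / \<epsilon>)"
    by (subst log_le_cancel_iff) (auto intro: less_le_trans[rotated])
  then have "(1 + real m) ^ N \<le> log 2 (\<kappa> / \<epsilon>)"
    by (simp add: log_nat_power add.commute)
  then have "log 2 ((1 + real m) ^ N) \<le> log 2 (log 2 (\<kappa> / \<epsilon>))"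
    by (subst log_le_cancel_iff) (auto intro: less_le_trans[rotated])
  then have "real N * log 2 (1 + real m) \<le> log 2 (log 2 (\<kappa> / \<epsilon>))"
    by (simp add: log_nat_power)
  moreover have "0 < log 2 (1 + real m)"
    using assms by simp
  ultimately show ?thesis
    by (simp add: field_simps)
qed

theorem theorem6p3:
  fixes f :: "real^'n \<Rightarrow> real" and \<psi> :: "real^'n \<Rightarrow> ereal"
    and F' :: "real^'n \<Rightarrow> real^'n"
    and L \<mu> \<tau>0 \<epsilon> \<kappa> :: real and m :: nat and x0 :: "real^'n"
    and x :: "nat \<Rightarrow> real^'n" and \<tau> :: "nat \<Rightarrow> real"
    and C :: "nat \<Rightarrow> nat \<Rightarrow> (real^'n) call"
  assumes f: "twice_cont_diff f"
    and psi: "proper_closed_convex \<psi>"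
    and bounded_below: "(INF y\<in>edom \<psi>. objective f \<psi> y) > -\<infinity>"
    and selection: "subgradient_selection f \<psi> F'"
    and L: "L \<ge> 0"
    and A1: "\<forall>y z. spectral_norm (hessian f z - hessian f y) \<le> L * norm (z - y)"
    and mu: "\<mu> > 0"
    and A2: "\<forall>y\<in>edom \<psi>. psd (hessian f y - \<mu> *\<^sub>R mat 1)"
    and params: "\<tau>0 > 0" "\<epsilon> > 0" "m \<ge> 1"
    and kappa: "\<kappa> = rate_const \<mu> L \<tau>0 m"
    and start: "x0 \<in> local_region f \<psi> F' \<epsilon> \<kappa>"
    and tau0: "\<tau>0 \<ge> 2 * grad_const\<^sup>2 * L / 3"
    and run: "zero_order_cnm f \<psi> x0 \<tau>0 \<epsilon> m x \<tau> C"
  shows "ereal_of_enat (first_hit f F' \<epsilon> C)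
           \<le> ereal (1 / log 2 (1 + real m) * log 2 (log 2 (\<kappa> / \<epsilon>)) + 1)"
proof -
  interpret lipschitz_hessian f L
    using f A1 L by unfold_locales auto
  define X where "X = max \<tau>0 L"
  have X: "L \<le> X" "\<tau>0 \<le> X"
    by (simp_all add: X_def)
  have \<kappa>: "0 < \<kappa>" "334 * (real m * X * \<kappa>) \<le> \<mu>\<^sup>2"
    using rate_const_bounds mu L params kappa by (simp_all add: X_def)
  have psi': "\<psi> y \<noteq> -\<infinity>" for y
    using psi unfolding proper_closed_convex_def by blast
  define hit where "hit k \<longleftrightarrow> (\<exists>l t. executed C k l \<and> t \<le> steps (C k l) \<and>
      norm (iter_gradient f F' (C k l) t) \<le> \<epsilon>)" for k
  have call: "zero_order_cubic_steps f \<psi> (x k)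
      (fd_hessian f (cnm_stepsize CARD('n) m \<epsilon> (2 ^ l * \<tau> k)) (x k))
      (cnm_sigma m (2 ^ l * \<tau> k)) m \<epsilon> (C k l)" if "executed C k l" for k l
    using run that unfolding zero_order_cnm_def by blast
  have gradients: "\<epsilon> < norm (gradient f (iter (C k l) t) + subgr (C k l) t)"
    if "\<not> hit k" "executed C k l" "1 \<le> t" "t \<le> steps (C k l)" for k l t
  proof -
    have "\<not> norm (iter_gradient f F' (C k l) t) \<le> \<epsilon>"
      using that unfolding hit_def by blast
    then show ?thesis
      using that(3) by (simp add: iter_gradient_def)
  qed
  \<comment> \<open>Termination of the earlier inner loops is carried along, since a call counts as
    executed only after them. The subgradient is existential: initially it comes from
    \<open>F'\<close>, later from the last cubic step.\<close>
  have invariant: "(\<forall>j<N. iteration_ends C j) \<and> \<tau>0 \<le> \<tau> N \<and> \<tau> N \<le> X \<and>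
      (\<exists>s\<in>subdiff \<psi> (x N). \<epsilon> \<le> norm (gradient f (x N) + s) \<and>
        norm (gradient f (x N) + s) \<le> \<kappa> * (1/2) ^ (Suc m ^ N))"
    if "\<forall>k<N. \<not> hit k" for N
    using that
  proof (induction N)
    case 0
    have "F' x0 \<in> objective_subdiff f \<psi> x0" "\<epsilon> \<le> norm (F' x0)" "norm (F' x0) \<le> \<kappa> / 2"
      using start selection unfolding local_region_def subgradient_selection_def by auto
    then have "\<exists>s\<in>subdiff \<psi> x0. \<epsilon> \<le> norm (gradient f x0 + s) \<and> norm (gradient f x0 + s) \<le> \<kappa> / 2"
      unfolding objective_subdiff_def by auto
    then show ?case
      using run X by (simp add: zero_order_cnm_def)
  next
    case (Suc N)
    then have ends: "\<forall>j<N. iteration_ends C j" and \<tau>N: "\<tau>0 \<le> \<tau> N" "\<tau> N \<le> X"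
      and "\<exists>s\<in>subdiff \<psi> (x N). \<epsilon> \<le> norm (gradient f (x N) + s) \<and>
        norm (gradient f (x N) + s) \<le> \<kappa> * (1/2) ^ (Suc m ^ N)"
      and no_hit: "\<not> hit N"
      by auto
    then obtain s where s: "s \<in> subdiff \<psi> (x N)" "\<epsilon> \<le> norm (gradient f (x N) + s)"
      "norm (gradient f (x N) + s) \<le> \<kappa> * (1/2) ^ (Suc m ^ N)"
      by blast
    have xN: "x N \<in> edom \<psi>"
      using s(1) unfolding subdiff_def by blast
    have \<tau>pos: "0 < 2 ^ l * \<tau> N" for l
      using \<tau>N params by simp
    have succeeds: "flag (C N l) = Success" if "executed C N l" "L \<le> 2 ^ l * \<tau> N" for l
      using call_succeeds[OF psi' xN \<tau>pos params(2,3) call[OF that(1)] that(2)]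
        gradients[OF no_hit that(1)] by blast
    have ends_N: "iteration_ends C N"
    \<comment> \<open>If every call halted, the trial values would double past \<open>L\<close>,
      where a call must succeed.\<close>
    proof (rule ccontr)
      assume never: "\<not> iteration_ends C N"
      then have "flag (C N l) = Halt" for l
        unfolding iteration_ends_def by (metis status.exhaust)
      then have "executed C N l" for l
        using ends unfolding executed_def by blast
      moreover obtain l where "L / \<tau> N < 2 ^ l"
        using real_arch_pow[of 2] by auto
      then have "L \<le> 2 ^ l * \<tau> N"
        using \<tau>N params by (simp add: field_simps)
      ultimately show False
        using succeeds never unfolding iteration_ends_def by blast
    qed
    define l where "l = last_inner C N"
    have success: "flag (C N l) = Success"
      using LeastI_ex[of "\<lambda>l. flag (C N l) = Success"] ends_N
      unfolding l_def last_inner_def iteration_ends_def by simp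
    have halts: "flag (C N i) = Halt" if "i < l" for i
      using not_less_Least[of i "\<lambda>l. flag (C N l) = Success"] that
      unfolding l_def last_inner_def by (cases "flag (C N i)") auto
    then have exec: "executed C N i" if "i \<le> l" for i
      using ends that unfolding executed_def by auto
    define \<theta> where "\<theta> = 2 ^ l * \<tau> N"
    have "1 * \<tau> N \<le> \<theta>"
      unfolding \<theta>_def using \<tau>N params by (intro mult_right_mono) auto
    then have \<theta>_lower: "L * grad_const\<^sup>2 \<le> 3/2 * \<theta>"
      using tau0 \<tau>N by (simp add: mult.commute)
    \<comment> \<open>Either the first trial succeeded and the value is \<open>\<tau> N\<close>, or
      the previous trial halted and was therefore below \<open>L\<close>.\<close>
    have \<theta>_upper: "\<theta> \<le> 2 * X"
    proof (cases l)
      case 0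
      then show ?thesis
        using \<tau>N params by (simp add: \<theta>_def)
    next
      case (Suc i)
      then have "\<not> L \<le> 2 ^ i * \<tau> N"
        using succeeds[of i] halts[of i] exec[of i] by auto
      then show ?thesis
        using X Suc by (simp add: \<theta>_def)
    qed
    have ends': "\<forall>j\<le>N. iteration_ends C j"
      using ends ends_N by (auto simp: le_less)
    have next_iter: "x (Suc N) = iter (C N l) (steps (C N l))"
      "\<tau> (Suc N) = max \<tau>0 (2 powi (int l - 1) * \<tau> N)"
      using run ends' unfolding zero_order_cnm_def l_def by blast+
    \<comment> \<open>The exponent is an integer, so for \<open>l = 0\<close> the value is halved as
      well. The halving restores the bound by \<open>X\<close> after a trial value of up to
      \<open>2 * X\<close>.\<close>
    have \<tau>_next: "\<tau> (Suc N) = max \<tau>0 (\<theta> / 2)"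
      unfolding next_iter \<theta>_def by (simp add: power_int_diff)
    note callN = psi' xN \<tau>pos params(2,3) call[OF exec[OF order_refl]]
    have half: "\<kappa> * (1/2) ^ (Suc m ^ N) \<le> \<kappa> / 2"
      using \<kappa>(1) power_decreasing[of 1 "Suc m ^ N" "1/2::real"] by simp
    note superlinear = call_superlinear[OF callN success gradients[OF no_hit exec[OF order_refl]]
        s(1,2) order_trans[OF s(3) half] mu A2[rule_format, OF xN]
        \<theta>_lower[unfolded \<theta>_def] \<theta>_upper[unfolded \<theta>_def] X(1) \<kappa>(2)]
    have steps: "steps (C N l) = m"
      by (rule superlinear(1))
    let ?s = "subgr (C N l) m"
    have "norm (gradient f (x (Suc N)) + ?s) \<le> \<kappa> * (norm (gradient f (x N) + s) / \<kappa>) ^ Suc m"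
      using superlinear(2) by (simp add: next_iter steps)
    also have "\<dots> \<le> \<kappa> * ((1/2) ^ (Suc m ^ N)) ^ Suc m"
      using s(3) \<kappa>(1) by (intro mult_left_mono power_mono) (auto simp: field_simps)
    \<comment> \<open>One outer iteration multiplies the exponent by \<open>m + 1\<close>, which is
      the source of the logarithm to base \<open>1 + m\<close>.\<close>
    also have "((1/2::real) ^ (Suc m ^ N)) ^ Suc m = (1/2) ^ (Suc m ^ Suc N)"
      by (metis power_mult power_Suc2)
    finally have bound: "norm (gradient f (x (Suc N)) + ?s) \<le> \<kappa> * (1/2) ^ (Suc m ^ Suc N)" .
    moreover have "?s \<in> subdiff \<psi> (x (Suc N))"
      using call_subdiff[OF callN, of m] params steps by (simp add: next_iter)
    moreover have "\<epsilon> \<le> norm (gradient f (x (Suc N)) + ?s)"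
      using gradients[OF no_hit exec[OF order_refl], of m] params steps by (simp add: next_iter)
    moreover have "\<tau>0 \<le> \<tau> (Suc N)" "\<tau> (Suc N) \<le> X"
      using \<tau>_next \<theta>_upper X by auto
    moreover have "\<forall>j<Suc N. iteration_ends C j"
      using ends' by auto
    ultimately show ?case
      by blast
  qed
  let ?bound = "1 / log 2 (1 + real m) * log 2 (log 2 (\<kappa> / \<epsilon>))"
  have N_le: "real N \<le> ?bound" if "\<forall>k<N. \<not> hit k" for N
    using invariant[OF that] params order_trans by (intro double_log_bound) blast+
  \<comment> \<open>A run without a hit would satisfy \<open>N_le\<close> for every
    \<open>N\<close>, so some iteration below \<open>M\<close> is a hit and the first one is
    finite.\<close>
  obtain M :: nat where "?bound < real M"
    using reals_Archimedean2 by blast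
  then have "\<exists>k. hit k"
    using N_le[of M] by force
  then obtain T where hit: "hit T" and minimal: "\<forall>k<T. \<not> hit k"
    using exists_least_iff[of hit] by blast
  have "first_hit f F' \<epsilon> C \<le> enat T"
    unfolding first_hit_def using hit unfolding hit_def by (intro Inf_lower) blast
  then have "ereal_of_enat (first_hit f F' \<epsilon> C) \<le> ereal_of_enat (enat T)"
    by (simp only: ereal_of_enat_le_iff)
  also have "\<dots> = ereal (real T)"
    by simp
  also have "\<dots> \<le> ereal (?bound + 1)"
    using N_le[OF minimal] by simp
  finally show ?thesis .
qed

end
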